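(* Let $E$ be a Dedekind complete vector lattice and let $\mathcal{Y}=(\mathcal{Y},p,{}^*E)$ be an internal lattice-normed ordered vector space which is $p$-semimonotone with a finite constant of semimonotonicity $\mathcal{M}\in\mathrm{fin}({}^*\mathbb{R})$, i.e. $0\le y\le x$ in $\mathcal{Y}$ implies $p(y)\le \mathcal{M}p(x)$. Then $\overline{\mathcal{Y}}=\mathbf{fin}(\mathcal{Y})/\mathbf{n}(\mathcal{Y})$, with the quotient ordering, is an ordered vector space. Moreover, the lattice-normed ordered vector space $(\overline{\mathcal{Y}},\overline{p},E)$ is $\overline{p}$-semimonotone with the constant of semimonotonicity $M=\mathrm{st}(\mathcal{M})$, i.e. $0\le a\le b$ in $\overline{\mathcal{Y}}$ implies $\overline{p}(a)\le \mathrm{st}(\mathcal{M})\,\overline{p}(b)$.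
   Context: An ordered vector space (OVS) is a real vector space with a partial order compatible with the linear structure; given standard OVSs (including the norming lattice $E$) are Archimedean with generating positive cone. A lattice-normed space (LNS) $(X,p,E)$ consists of a real vector space $X$, a vector lattice $E$, and a map $p:X\to E_+$ with $p(x)=0\iff x=0$, $p(\lambda x)=|\lambda|p(x)$, $p(x+y)\le p(x)+p(y)$. It is a lattice-normed ordered vector space (LNOVS) if $X$ is an OVS (no compatibility between $p$ and the order is required). Work in a polysaturated nonstandard enlargement (general saturation principle). $\mathrm{fin}({}^*\mathbb{R})$ is the set of finite hyperreals and $\mathrm{st}$ the standard part. $E$ is a fixed standard Dedekind complete vector lattice. An internal LNOVS $(\mathcal{Y},p,{}^*E)$ is an internal triple satisfying the transferred axioms of an LNOVS (so $\mathcal{Y}$ is an internal ordered vector space over ${}^*\mathbb{R}$ and $p:\mathcal{Y}\to{}^*E_+$ is internal). Put $\mathrm{fin}({}^*E)=\{\kappa\in{}^*E:\exists e\in E,\ -e\le\kappa\le e\}$, $\eta({}^*E)=\{\kappa\in{}^*E:\inf_E\{e\in E:-e\le\kappa\le e\}=0\}$, $\mathbf{fin}(\mathcal{Y})=\{x\in\mathcal{Y}:p(x)\in\mathrm{fin}({}^*E)\}$, $\mathbf{n}(\mathcal{Y})=\{x\in\mathcal{Y}:p(x)\in\eta({}^*E)\}$ (external real vector spaces), $\overline{\mathcal{Y}}=\mathbf{fin}(\mathcal{Y})/\mathbf{n}(\mathcal{Y})$, and $\overline{p}([x])=\inf_E\{e\in E:e\ge p(x)\}$ for $x\in\mathbf{fin}(\mathcal{Y})$,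 a well-defined $E$-valued norm on $\overline{\mathcal{Y}}$. The quotient ordering: $[x]\ge 0$ iff there is $x'\in\mathbf{fin}(\mathcal{Y})$ with $x'\ge 0$ and $[x']=[x]$. *)

theory Defs
  imports Complex_Main "HOL-Algebra.Module" "HOL-Algebra.AbelCoset" "HOL-Library.Extended_Nat"
begin

record 'u universe =
  mem :: "'u \<Rightarrow> 'u \<Rightarrow> bool"
  atoms :: "'u set"

definition elts :: "'u universe \<Rightarrow> 'u \<Rightarrow> 'u set" where
  "elts U x = {y. mem U y x}"

primrec level :: "'u universe \<Rightarrow> nat \<Rightarrow> 'u set" where
  "level U 0 = atoms U"
| "level U (Suc n) = level U n \<union> {x. x \<notin> atoms U \<and> elts U x \<subseteq> level U n}"

text \<open>
  For \<open>h = \<infinity>\<close> this is the full superstructure \<open>V(S)\<close> over the set \<open>S\<close> of atoms, the union of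
  \<open>V\<^sub>0(S) = S\<close> and \<open>V\<^sub>n\<^sub>+\<^sub>1(S) = V\<^sub>n(S) \<union> Pow (V\<^sub>n(S))\<close>.  A finite \<open>h\<close> gives \<open>V\<^sub>h(S)\<close>.
  Finite heights are admitted because \<open>V(S)\<close> over an infinite \<open>S\<close> has the cardinality of an
  infinite union of iterated power sets, so that HOL alone does not provide a type for it, while it
  does for every \<open>V\<^sub>h(S)\<close> with finite \<open>h\<close>.
\<close>

definition superstructure :: "'u universe \<Rightarrow> enat \<Rightarrow> bool" where
  "superstructure U h \<longleftrightarrow>
     (\<forall>x\<in>atoms U. elts U x = {}) \<and>
     (\<forall>x y. x \<notin> atoms U \<longrightarrow> y \<notin> atoms U \<longrightarrow> elts U x = elts U y \<longrightarrow> x = y) \<and>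
     (\<forall>x. \<exists>n. enat n \<le> h \<and> x \<in> level U n) \<and>
     (\<forall>n A. enat n < h \<longrightarrow> A \<subseteq> level U n \<longrightarrow> (\<exists>x. x \<notin> atoms U \<and> elts U x = A))"

definition set_of :: "'u universe \<Rightarrow> 'u set \<Rightarrow> 'u" where
  "set_of U A = (THE x. x \<notin> atoms U \<and> elts U x = A)"

definition pair :: "'u universe \<Rightarrow> 'u \<Rightarrow> 'u \<Rightarrow> 'u" where
  "pair U x y = set_of U {set_of U {x}, set_of U {x, y}}"

definition pairs :: "'u universe \<Rightarrow> 'u set \<Rightarrow> 'u set \<Rightarrow> 'u set" where
  "pairs U A B = {pair U x y |x y. x \<in> A \<and> y \<in> B}"

definition is_fun :: "'u universe \<Rightarrow> 'u \<Rightarrow> 'u set \<Rightarrow> 'u set \<Rightarrow> bool" where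
  "is_fun U f A B \<longleftrightarrow> elts U f \<subseteq> pairs U A B \<and> (\<forall>x\<in>A. \<exists>!y. mem U (pair U x y) f)"

definition app :: "'u universe \<Rightarrow> 'u \<Rightarrow> 'u \<Rightarrow> 'u" where
  "app U f x = (THE y. mem U (pair U x y) f)"

definition app2 :: "'u universe \<Rightarrow> 'u \<Rightarrow> 'u \<Rightarrow> 'u \<Rightarrow> 'u" where
  "app2 U f x y = app U f (pair U x y)"

definition holds_rel :: "'u universe \<Rightarrow> 'u \<Rightarrow> 'u \<Rightarrow> 'u \<Rightarrow> bool" where
  "holds_rel U r x y \<longleftrightarrow> mem U (pair U x y) r"

text \<open>
  Formulas of the language of \<open>\<in>\<close> and \<open>=\<close> with bounded quantifiers only; variables are natural
  numbers and \<open>BAll i j \<phi>\<close> stands for \<open>\<forall>x\<^sub>i \<in> x\<^sub>j. \<phi>\<close> (with \<open>x\<^sub>j\<close> evaluated outside the quantifier).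
  Constants are the values of free variables.
\<close>

datatype bform = Mem nat nat | Eq nat nat | Neg bform | Conj bform bform | BAll nat nat bform

primrec sat :: "'u universe \<Rightarrow> bform \<Rightarrow> (nat \<Rightarrow> 'u) \<Rightarrow> bool" where
  "sat U (Mem i j) v \<longleftrightarrow> mem U (v i) (v j)"
| "sat U (Eq i j) v \<longleftrightarrow> v i = v j"
| "sat U (Neg \<phi>) v \<longleftrightarrow> \<not> sat U \<phi> v"
| "sat U (Conj \<phi> \<psi>) v \<longleftrightarrow> sat U \<phi> v \<and> sat U \<psi> v"
| "sat U (BAll i j \<phi>) v \<longleftrightarrow> (\<forall>a\<in>elts U (v j). sat U \<phi> (v(i := a)))"

text \<open>
  The standard universe \<open>V(S)\<close>, the nonstandard universe \<open>V(\<^sup>*S)\<close>, the map \<open>*\<close>, and the copies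
  inside \<open>V(S)\<close> of the real numbers and of the standard space \<open>E\<close> (here a type \<open>'e\<close>).
\<close>

record ('v, 'w, 'e) nsa =
  std :: "'v universe"
  nst :: "'w universe"
  star :: "'v \<Rightarrow> 'w"
  rcode :: "real \<Rightarrow> 'v"
  ecode :: "'e \<Rightarrow> 'v"

definition internal :: "('v, 'w, 'e) nsa \<Rightarrow> 'w \<Rightarrow> bool" where
  "internal N x \<longleftrightarrow> (\<exists>a. mem (nst N) x (star N a))"

definition transfer_principle :: "('v, 'w, 'e) nsa \<Rightarrow> bool" where
  "transfer_principle N \<longleftrightarrow> (\<forall>\<phi> v. sat (std N) \<phi> v \<longleftrightarrow> sat (nst N) \<phi> (star N \<circ> v))"

text \<open>General saturation: families of internal sets indexed by a standard set.\<close>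

definition saturation_principle :: "('v, 'w, 'e) nsa \<Rightarrow> bool" where
  "saturation_principle N \<longleftrightarrow>
     (\<forall>\<Gamma> (A :: 'v \<Rightarrow> 'w).
        (\<forall>\<gamma>\<in>elts (std N) \<Gamma>. internal N (A \<gamma>)) \<longrightarrow>
        (\<forall>F. finite F \<longrightarrow> F \<subseteq> elts (std N) \<Gamma> \<longrightarrow> (\<exists>x. \<forall>\<gamma>\<in>F. mem (nst N) x (A \<gamma>))) \<longrightarrow>
        (\<exists>x. \<forall>\<gamma>\<in>elts (std N) \<Gamma>. mem (nst N) x (A \<gamma>)))"

text \<open>
  The bound \<open>n + 5\<close> is the level needed for graphs of binary operations (sets of Kuratowski pairs
  \<open>((x, y), z)\<close>) on sets of objects of level \<open>n\<close>; it is no restriction for \<open>h = \<infinity>\<close>.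
\<close>

definition polysaturated_enlargement :: "('v, 'w, 'e) nsa \<Rightarrow> enat \<Rightarrow> bool" where
  "polysaturated_enlargement N h \<longleftrightarrow>
     superstructure (std N) h \<and> superstructure (nst N) h \<and>
     elts (nst N) (star N (set_of (std N) (atoms (std N)))) = atoms (nst N) \<and>
     transfer_principle N \<and> saturation_principle N \<and>
     inj (rcode N) \<and> inj (ecode N) \<and>
     (\<exists>n. enat (n + 5) \<le> h \<and> range (rcode N) \<union> range (ecode N) \<subseteq> level (std N) n)"

record 'k oring = "'k ring" +
  sle :: "'k \<Rightarrow> 'k \<Rightarrow> bool"

record ('k, 'x) omodule = "('k, 'x) module" +
  vle :: "'x \<Rightarrow> 'x \<Rightarrow> bool"

definition sabs :: "'k oring \<Rightarrow> 'k \<Rightarrow> 'k" where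
  "sabs K a = (if sle K \<zero>\<^bsub>K\<^esub> a then a else \<ominus>\<^bsub>K\<^esub> a)"

text \<open>
  The scalars \<open>K\<close> are a parameter in order to express both ordered vector spaces over the reals and,
  by transfer, internal ones over the hyperreals.
\<close>

definition ordered_vector_space :: "'k oring \<Rightarrow> ('k, 'x) omodule \<Rightarrow> bool" where
  "ordered_vector_space K X \<longleftrightarrow>
     field K \<and> Module.module K X \<and>
     (\<forall>x\<in>carrier X. vle X x x) \<and>
     (\<forall>x\<in>carrier X. \<forall>y\<in>carrier X. vle X x y \<longrightarrow> vle X y x \<longrightarrow> x = y) \<and>
     (\<forall>x\<in>carrier X. \<forall>y\<in>carrier X. \<forall>z\<in>carrier X. vle X x y \<longrightarrow> vle X y z \<longrightarrow> vle X x z) \<and>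
     (\<forall>x\<in>carrier X. \<forall>y\<in>carrier X. \<forall>z\<in>carrier X.
        vle X x y \<longrightarrow> vle X (x \<oplus>\<^bsub>X\<^esub> z) (y \<oplus>\<^bsub>X\<^esub> z)) \<and>
     (\<forall>a\<in>carrier K. \<forall>x\<in>carrier X. \<forall>y\<in>carrier X.
        sle K \<zero>\<^bsub>K\<^esub> a \<longrightarrow> vle X x y \<longrightarrow> vle X (a \<odot>\<^bsub>X\<^esub> x) (a \<odot>\<^bsub>X\<^esub> y))"

definition vector_lattice :: "'k oring \<Rightarrow> ('k, 'x) omodule \<Rightarrow> bool" where
  "vector_lattice K X \<longleftrightarrow>
     ordered_vector_space K X \<and>
     (\<forall>x\<in>carrier X. \<forall>y\<in>carrier X.
        (\<exists>s\<in>carrier X. vle X x s \<and> vle X y s \<and>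
           (\<forall>u\<in>carrier X. vle X x u \<longrightarrow> vle X y u \<longrightarrow> vle X s u)) \<and>
        (\<exists>i\<in>carrier X. vle X i x \<and> vle X i y \<and>
           (\<forall>u\<in>carrier X. vle X u x \<longrightarrow> vle X u y \<longrightarrow> vle X u i)))"

definition lnovs ::
  "'k oring \<Rightarrow> ('k, 'x) omodule \<Rightarrow> ('k, 'l) omodule \<Rightarrow> ('x \<Rightarrow> 'l) \<Rightarrow> bool" where
  "lnovs K X L p \<longleftrightarrow>
     ordered_vector_space K X \<and> vector_lattice K L \<and>
     (\<forall>x\<in>carrier X. p x \<in> carrier L \<and> vle L \<zero>\<^bsub>L\<^esub> (p x)) \<and>
     (\<forall>x\<in>carrier X. p x = \<zero>\<^bsub>L\<^esub> \<longleftrightarrow> x = \<zero>\<^bsub>X\<^esub>) \<and>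
     (\<forall>a\<in>carrier K. \<forall>x\<in>carrier X. p (a \<odot>\<^bsub>X\<^esub> x) = sabs K a \<odot>\<^bsub>L\<^esub> p x) \<and>
     (\<forall>x\<in>carrier X. \<forall>y\<in>carrier X. vle L (p (x \<oplus>\<^bsub>X\<^esub> y)) (p x \<oplus>\<^bsub>L\<^esub> p y))"

definition semimonotone ::
  "('k, 'x) omodule \<Rightarrow> ('k, 'l) omodule \<Rightarrow> ('x \<Rightarrow> 'l) \<Rightarrow> 'k \<Rightarrow> bool" where
  "semimonotone X L p M \<longleftrightarrow>
     (\<forall>x\<in>carrier X. \<forall>y\<in>carrier X.
        vle X \<zero>\<^bsub>X\<^esub> y \<longrightarrow> vle X y x \<longrightarrow> vle L (p y) (M \<odot>\<^bsub>L\<^esub> p x))"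

definition real_scalars :: "real oring" where
  "real_scalars = \<lparr>carrier = UNIV, mult = (*), one = 1, zero = 0, add = (+), sle = (\<le>)\<rparr>"

text \<open>The ring multiplication and unit are unused components of a module.\<close>

definition std_space :: "(real, 'e :: {ordered_real_vector, conditionally_complete_lattice}) omodule" where
  "std_space = \<lparr>carrier = UNIV, mult = undefined, one = undefined, zero = 0, add = (+),
     smult = scaleR, vle = (\<le>)\<rparr>"

definition star_set :: "('v, 'w, 'e) nsa \<Rightarrow> 'v set \<Rightarrow> 'w set" where
  "star_set N A = elts (nst N) (star N (set_of (std N) A))"

definition star_op ::
  "('v, 'w, 'e) nsa \<Rightarrow> ('a \<Rightarrow> 'v) \<Rightarrow> ('b \<Rightarrow> 'v) \<Rightarrow> ('c \<Rightarrow> 'v) \<Rightarrow> ('a \<Rightarrow> 'b \<Rightarrow> 'c) \<Rightarrow> 'w \<Rightarrow> 'w \<Rightarrow> 'w" where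
  "star_op N ca cb cc f =
     app2 (nst N) (star N (set_of (std N)
       {pair (std N) (pair (std N) (ca x) (cb y)) (cc (f x y)) |x y. True}))"

definition star_rel ::
  "('v, 'w, 'e) nsa \<Rightarrow> ('a \<Rightarrow> 'v) \<Rightarrow> ('b \<Rightarrow> 'v) \<Rightarrow> ('a \<Rightarrow> 'b \<Rightarrow> bool) \<Rightarrow> 'w \<Rightarrow> 'w \<Rightarrow> bool" where
  "star_rel N ca cb R =
     holds_rel (nst N) (star N (set_of (std N) {pair (std N) (ca x) (cb y) |x y. R x y}))"

definition star_real :: "('v, 'w, 'e) nsa \<Rightarrow> real \<Rightarrow> 'w" where
  "star_real N r = star N (rcode N r)"

definition star_vec :: "('v, 'w, 'e) nsa \<Rightarrow> 'e \<Rightarrow> 'w" where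
  "star_vec N e = star N (ecode N e)"

definition hyperreals :: "('v, 'w, 'e) nsa \<Rightarrow> 'w oring" where
  "hyperreals N =
     \<lparr>carrier = star_set N (range (rcode N)),
      mult = star_op N (rcode N) (rcode N) (rcode N) (*),
      one = star_real N 1,
      zero = star_real N 0,
      add = star_op N (rcode N) (rcode N) (rcode N) (+),
      sle = star_rel N (rcode N) (rcode N) (\<le>)\<rparr>"

definition star_space ::
  "('v, 'w, 'e :: {ordered_real_vector, conditionally_complete_lattice}) nsa \<Rightarrow> ('w, 'w) omodule" where
  "star_space N =
     \<lparr>carrier = star_set N (range (ecode N)),
      mult = undefined,
      one = undefined,
      zero = star_vec N 0,
      add = star_op N (ecode N) (ecode N) (ecode N) (+),
      smult = star_op N (rcode N) (ecode N) (ecode N) scaleR,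
      vle = star_rel N (ecode N) (ecode N) (\<le>)\<rparr>"

definition fin_hyperreals :: "('v, 'w, 'e) nsa \<Rightarrow> 'w set" where
  "fin_hyperreals N =
     {a \<in> carrier (hyperreals N). \<exists>r. sle (hyperreals N) (star_real N (- r)) a \<and>
        sle (hyperreals N) a (star_real N r)}"

definition st :: "('v, 'w, 'e) nsa \<Rightarrow> 'w \<Rightarrow> real" where
  "st N a = (THE r. \<forall>\<epsilon>>0. sle (hyperreals N) (star_real N (r - \<epsilon>)) a \<and>
     sle (hyperreals N) a (star_real N (r + \<epsilon>)))"

definition fin_vec ::
  "('v, 'w, 'e :: {ordered_real_vector, conditionally_complete_lattice}) nsa \<Rightarrow> 'w set" where
  "fin_vec N =
     {\<kappa> \<in> carrier (star_space N). \<exists>e. vle (star_space N) (star_vec N (- e)) \<kappa> \<and>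
        vle (star_space N) \<kappa> (star_vec N e)}"

text \<open>
  Membership in \<open>fin_vec\<close> makes the set of bounds nonempty; without it the infimum would
  be the unspecified value \<open>Inf {}\<close>.
\<close>

definition eta_vec ::
  "('v, 'w, 'e :: {ordered_real_vector, conditionally_complete_lattice}) nsa \<Rightarrow> 'w set" where
  "eta_vec N =
     {\<kappa> \<in> fin_vec N. Inf {e. vle (star_space N) (star_vec N (- e)) \<kappa> \<and>
        vle (star_space N) \<kappa> (star_vec N e)} = 0}"

text \<open>The components are objects of the nonstandard universe; functions and relations are given by their graphs.\<close>

record 'w int_space =
  icarrier :: 'w
  izero :: 'w
  iadd :: 'w
  ismult :: 'w
  ile :: 'w

definition space_of :: "('v, 'w, 'e) nsa \<Rightarrow> 'w int_space \<Rightarrow> ('w, 'w) omodule" where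
  "space_of N Y =
     \<lparr>carrier = elts (nst N) (icarrier Y),
      mult = undefined,
      one = undefined,
      zero = izero Y,
      add = app2 (nst N) (iadd Y),
      smult = app2 (nst N) (ismult Y),
      vle = holds_rel (nst N) (ile Y)\<rparr>"

definition internal_lnovs ::
  "('v, 'w, 'e :: {ordered_real_vector, conditionally_complete_lattice}) nsa \<Rightarrow>
   'w int_space \<Rightarrow> 'w \<Rightarrow> bool" where
  "internal_lnovs N Y p \<longleftrightarrow>
     (let W = nst N; C = elts W (icarrier Y) in
      internal N (icarrier Y) \<and> internal N (iadd Y) \<and> internal N (ismult Y) \<and>
      internal N (ile Y) \<and> internal N p \<and>
      is_fun W (iadd Y) (pairs W C C) C \<and>
      is_fun W (ismult Y) (pairs W (carrier (hyperreals N)) C) C \<and>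
      elts W (ile Y) \<subseteq> pairs W C C \<and>
      is_fun W p C (carrier (star_space N)) \<and>
      lnovs (hyperreals N) (space_of N Y) (star_space N) (app W p))"

context
  fixes N :: "('v, 'w, 'e :: {ordered_real_vector, conditionally_complete_lattice}) nsa"
    and Y :: "'w int_space" and p :: 'w
begin

definition finY :: "'w set" where
  "finY = {x \<in> carrier (space_of N Y). app (nst N) p x \<in> fin_vec N}"

definition nY :: "'w set" where
  "nY = {x \<in> carrier (space_of N Y). app (nst N) p x \<in> eta_vec N}"

definition cls :: "'w \<Rightarrow> 'w set" where
  "cls x = nY +>\<^bsub>space_of N Y\<^esub> x"

definition quot_vs :: "(real, 'w set) module" where
  "quot_vs =
     \<lparr>carrier = cls ` finY,
      mult = undefined,
      one = undefined,
      zero = cls \<zero>\<^bsub>space_of N Y\<^esub>,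
      add = (\<lambda>A B. A <+>\<^bsub>space_of N Y\<^esub> B),
      smult = (\<lambda>r A. \<Union>a\<in>A. cls (star_real N r \<odot>\<^bsub>space_of N Y\<^esub> a))\<rparr>"

definition quot_pos :: "'w set set" where
  "quot_pos = {cls x |x. x \<in> finY \<and> vle (space_of N Y) \<zero>\<^bsub>space_of N Y\<^esub> x}"

definition quot_space :: "(real, 'w set) omodule" where
  "quot_space =
     Module.module.extend quot_vs (omodule.fields (\<lambda>A B. B \<ominus>\<^bsub>quot_vs\<^esub> A \<in> quot_pos))"

definition quot_norm :: "'w set \<Rightarrow> 'e" where
  "quot_norm A =
     (THE u. \<exists>x\<in>A. u = Inf {e. vle (star_space N) (app (nst N) p x) (star_vec N e)})"

end

end

theory Submission
  imports Defs
begin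

text \<open>
  The map \<open>x \<mapsto> Inf {e. p x \<le> *e}\<close> is an \<open>E\<close>-valued seminorm on the finite elements whose kernel
  consists of the infinitesimal ones.  If \<open>[x] \<le> [y] \<le> [x]\<close>, there are finite \<open>z, w \<ge> 0\<close> with
  \<open>[y] = [x + z]\<close>, \<open>[x] = [y + w]\<close>, so \<open>z + w\<close> is infinitesimal; as \<open>0 \<le> z \<le> z + w\<close>,
  semimonotonicity makes \<open>z\<close> infinitesimal.  The constant \<open>st M\<close> arises from
  \<open>M \<le> st M + \<delta>\<close> for all \<open>\<delta> > 0\<close>, because a Dedekind complete \<open>E\<close> is Archimedean.

  The delicate point is that the operations of the hyperreals and of \<open>*E\<close> are unspecified at some
  arguments when the height \<open>h\<close> is finite.  For \<open>y\<close> of high level the pair \<open>(c, y)\<close> does not exist,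
  \<open>pair\<close> returns a junk object, and this may happen to lie in the graph of a function, so that the
  value at \<open>c\<close> is no longer unique.  Away from finitely many \<open>c\<close>, however, the result of
  \<open>app\<close> is a function of the true value alone, and then the field and module laws,
  applied to a generic decomposition of the arguments, force the true value on standard elements.
\<close>

section \<open>Superstructures and bounded formulas\<close>

definition is_upair :: "'u universe \<Rightarrow> 'u \<Rightarrow> 'u \<Rightarrow> 'u \<Rightarrow> bool" where
  "is_upair U t x y \<longleftrightarrow> elts U t = {x, y}"

text \<open>Kuratowski pairs as a relation on members. It avoids \<open>set_of\<close>, so it is
  meaningful even where the pair of two objects might not exist.\<close>

definition is_pair :: "'u universe \<Rightarrow> 'u \<Rightarrow> 'u \<Rightarrow> 'u \<Rightarrow> bool" where
  "is_pair U q x y \<longleftrightarrow> (\<exists>s t. elts U q = {s, t} \<and> elts U s = {x} \<and> elts U t = {x, y})"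

lemma is_pair_inject:
  assumes "is_pair U q x y" "is_pair U q x' y'"
  shows "x = x' \<and> y = y'"
proof -
  obtain s t where st: "elts U q = {s, t}" "elts U s = {x}" "elts U t = {x, y}"
    using assms(1) by (auto simp: is_pair_def)
  obtain s' t' where st': "elts U q = {s', t'}" "elts U s' = {x'}" "elts U t' = {x', y'}"
    using assms(2) by (auto simp: is_pair_def)
  have "{{x}, {x, y}} = {{x'}, {x', y'}}"
    using arg_cong[OF st(1)[symmetric, unfolded st'(1)], of "\<lambda>A. elts U ` A"] st st' by simp
  then show ?thesis by (auto simp: doubleton_eq_iff)
qed

text \<open>Membership of \<open>((x, y), z)\<close> in a graph. The inner pair \<open>c\<close> is
  reached as a member of a member of \<open>q\<close>, so every quantifier is bounded.\<close>

definition op_related :: "'u universe \<Rightarrow> 'u \<Rightarrow> 'u \<Rightarrow> 'u \<Rightarrow> 'u \<Rightarrow> bool" where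
  "op_related U F x y z \<longleftrightarrow>
     (\<exists>q\<in>elts U F. \<exists>t\<in>elts U q. \<exists>c\<in>elts U t. is_pair U q c z \<and> is_pair U c x y)"

section \<open>Bounded formulas for pairs, relations and graphs\<close>

definition Disj :: "bform \<Rightarrow> bform \<Rightarrow> bform" where
  "Disj \<phi> \<psi> = Neg (Conj (Neg \<phi>) (Neg \<psi>))"

definition BEx :: "nat \<Rightarrow> nat \<Rightarrow> bform \<Rightarrow> bform" where
  "BEx i j \<phi> = Neg (BAll i j (Neg \<phi>))"

definition Upair_form :: "nat \<Rightarrow> nat \<Rightarrow> nat \<Rightarrow> nat \<Rightarrow> bform" where
  "Upair_form w t x y = Conj (Mem x t) (Conj (Mem y t) (BAll w t (Disj (Eq w x) (Eq w y))))"

text \<open>The leading arguments here and below are the bound variables; the disequations in the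
  \<open>sat\<close> lemmas exclude capture.\<close>

definition Pair_form :: "nat \<Rightarrow> nat \<Rightarrow> nat \<Rightarrow> nat \<Rightarrow> nat \<Rightarrow> bform" where
  "Pair_form s w q x y =
     Conj (BEx s q (Upair_form w s x x)) (Conj (BEx s q (Upair_form w s x y))
       (BAll s q (Disj (Upair_form w s x x) (Upair_form w s x y))))"

definition related :: "'u universe \<Rightarrow> 'u \<Rightarrow> 'u \<Rightarrow> 'u \<Rightarrow> bool" where
  "related U r x y \<longleftrightarrow> (\<exists>q\<in>elts U r. is_pair U q x y)"

definition Rel_form :: "nat \<Rightarrow> nat \<Rightarrow> nat \<Rightarrow> nat \<Rightarrow> nat \<Rightarrow> nat \<Rightarrow> bform" where
  "Rel_form s w q r x y = BEx q r (Pair_form s w q x y)"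

definition Op_form :: "nat \<Rightarrow> nat \<Rightarrow> nat \<Rightarrow> nat \<Rightarrow> nat \<Rightarrow> nat \<Rightarrow> nat \<Rightarrow> nat \<Rightarrow> nat \<Rightarrow> bform" where
  "Op_form s w q t c F x y z =
     BEx q F (BEx t q (BEx c t (Conj (Pair_form s w q c z) (Pair_form s w c x y))))"

lemma sat_Disj [simp]: "sat U (Disj \<phi> \<psi>) v \<longleftrightarrow> sat U \<phi> v \<or> sat U \<psi> v"
  by (auto simp: Disj_def)

lemma sat_BEx [simp]: "sat U (BEx i j \<phi>) v \<longleftrightarrow> (\<exists>a\<in>elts U (v j). sat U \<phi> (v(i := a)))"
  by (auto simp: BEx_def)

lemma sat_Upair_form [simp]:
  "w \<noteq> x \<Longrightarrow> w \<noteq> y \<Longrightarrow> sat U (Upair_form w t x y) v \<longleftrightarrow> is_upair U (v t) (v x) (v y)"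
  by (auto simp: Upair_form_def is_upair_def elts_def)

abbreviation junk :: 'u where "junk \<equiv> THE x. False"

text \<open>An unsatisfiable description is the description of the constantly false predicate, so
  all missing sets share the single value \<open>junk\<close>.\<close>

lemma set_of_none: "(\<And>x. x \<notin> atoms U \<Longrightarrow> elts U x \<noteq> A) \<Longrightarrow> set_of U A = junk"
  unfolding set_of_def by (rule arg_cong[where f = The]) auto

text \<open>Elements in \<open>below U h 1\<close> are members of some set, those in \<open>below U h 2\<close> members of members of sets.\<close>

definition below :: "'u universe \<Rightarrow> enat \<Rightarrow> nat \<Rightarrow> 'u set" where
  "below U h i = {x. \<exists>k. enat (k + i) \<le> h \<and> x \<in> level U k}"

section \<open>Levels of a superstructure and the existence of sets and pairs\<close>

locale superstr =
  fixes U :: "'u universe" and h :: enat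
  assumes superstructure: "superstructure U h"
begin

lemmas superstructureD = superstructure[unfolded superstructure_def]

lemma elts_atom: "x \<in> atoms U \<Longrightarrow> elts U x = {}"
  by (rule bspec[OF conjunct1[OF superstructureD]])

lemma extensional: "x \<notin> atoms U \<Longrightarrow> y \<notin> atoms U \<Longrightarrow> elts U x = elts U y \<Longrightarrow> x = y"
  using conjunct1[OF conjunct2[OF superstructureD]] by simp

lemma ex_level: "\<exists>n. enat n \<le> h \<and> x \<in> level U n"
  using conjunct1[OF conjunct2[OF conjunct2[OF superstructureD]]] by (rule spec)

lemma ex_set: "A \<subseteq> level U n \<Longrightarrow> enat (Suc n) \<le> h \<Longrightarrow> \<exists>x. x \<notin> atoms U \<and> elts U x = A"
  using conjunct2[OF conjunct2[OF conjunct2[OF superstructureD]]] by (simp add: Suc_ile_eq)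

text \<open>A nonempty extension excludes atoms, so extensionality for sets applies.\<close>

lemma extensional': "elts U x = elts U y \<Longrightarrow> elts U x \<noteq> {} \<Longrightarrow> x = y"
  using extensional[of x y] elts_atom[of x] elts_atom[of y] by auto

lemma set_of_eqI: "elts U x = A \<Longrightarrow> A \<noteq> {} \<Longrightarrow> set_of U A = x"
  unfolding set_of_def using elts_atom extensional by (intro the_equality) auto

lemma level_mono: "i \<le> j \<Longrightarrow> level U i \<subseteq> level U j"
  by (rule lift_Suc_mono_le) auto

lemma set_of:
  assumes "A \<subseteq> level U n" "enat (Suc n) \<le> h"
  shows elts_set_of: "elts U (set_of U A) = A" and set_of_notin_atoms: "set_of U A \<notin> atoms U"
proof -
  obtain x where x: "x \<notin> atoms U" "elts U x = A" using ex_set[OF assms] by blast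
  then have "set_of U A = x" unfolding set_of_def using extensional by (intro the_equality) auto
  with x show "elts U (set_of U A) = A" "set_of U A \<notin> atoms U" by auto
qed

lemma set_of_level: "A \<subseteq> level U n \<Longrightarrow> enat (Suc n) \<le> h \<Longrightarrow> set_of U A \<in> level U (Suc n)"
  using elts_set_of set_of_notin_atoms by simp

lemma elts_level: "x \<in> level U m \<Longrightarrow> y \<in> elts U x \<Longrightarrow> \<exists>k. m = Suc k \<and> y \<in> level U k"
proof (induction m)
  case 0
  then show ?case using elts_atom by auto
next
  case (Suc m)
  then show ?case using level_mono[of "m - 1" m] by fastforce
qed

lemma mem_below: "mem U x y \<Longrightarrow> y \<in> below U h i \<Longrightarrow> x \<in> below U h (Suc i)"
proof -
  assume "mem U x y" "y \<in> below U h i"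
  then obtain k where k: "enat (k + i) \<le> h" "y \<in> level U k" by (auto simp: below_def)
  then obtain l where "k = Suc l" "x \<in> level U l"
    using elts_level[of y k x] \<open>mem U x y\<close> by (auto simp: elts_def)
  with k show ?thesis by (auto simp: below_def)
qed

lemma below_0 [simp]: "x \<in> below U h 0"
  using ex_level by (auto simp: below_def)

lemma below_mono: "i \<le> j \<Longrightarrow> below U h j \<subseteq> below U h i"
proof
  fix x assume "i \<le> j" "x \<in> below U h j"
  then obtain k where "enat (k + j) \<le> h" "x \<in> level U k" by (auto simp: below_def)
  moreover have "enat (k + i) \<le> enat (k + j)" using \<open>i \<le> j\<close> by simp
  ultimately show "x \<in> below U h i" unfolding below_def by (blast intro: order_trans)
qed

lemma elts_below: "y \<in> elts U x \<Longrightarrow> x \<in> below U h i \<Longrightarrow> y \<in> below U h (Suc i)"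
  using mem_below by (simp add: elts_def)

lemma set_of_pair_below:
  assumes "x \<in> below U h (Suc i)" "y \<in> below U h (Suc i)"
  shows "elts U (set_of U {x, y}) = {x, y}" "set_of U {x, y} \<in> below U h i"
proof -
  obtain k l where k: "enat (k + Suc i) \<le> h" "x \<in> level U k" and l: "enat (l + Suc i) \<le> h" "y \<in> level U l"
    using assms by (auto simp: below_def)
  define m where "m = max k l"
  have m: "enat (m + Suc i) \<le> h" using k l by (auto simp: m_def max_def)
  have sub: "{x, y} \<subseteq> level U m"
    using k l level_mono[of k m] level_mono[of l m] by (auto simp: m_def)
  have h: "enat (Suc m) \<le> h" using m by (auto intro: order_trans[rotated])
  show "elts U (set_of U {x, y}) = {x, y}" by (rule elts_set_of[OF sub h])
  show "set_of U {x, y} \<in> below U h i"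
    using set_of_level[OF sub h] m by (auto simp: below_def intro!: exI[of _ "Suc m"] simp del: level.simps)
qed

lemma is_pair_eq: "is_pair U q x y \<Longrightarrow> pair U x y = q"
proof -
  assume "is_pair U q x y"
  then obtain s t where "elts U q = {s, t}" "elts U s = {x}" "elts U t = {x, y}"
    by (auto simp: is_pair_def)
  then show ?thesis
    using set_of_eqI[of s "{x}"] set_of_eqI[of t "{x, y}"] set_of_eqI[of q "{s, t}"]
    by (simp add: pair_def)
qed

lemma is_pair_pair:
  assumes "x \<in> below U h (Suc (Suc i))" "y \<in> below U h (Suc (Suc i))"
  shows "is_pair U (pair U x y) x y" "pair U x y \<in> below U h i"
proof -
  have x: "elts U (set_of U {x}) = {x}" "set_of U {x} \<in> below U h (Suc i)"
    using set_of_pair_below[OF assms(1,1)] by simp_all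
  note xy = set_of_pair_below[OF assms]
  show "is_pair U (pair U x y) x y" "pair U x y \<in> below U h i"
    unfolding is_pair_def pair_def using set_of_pair_below[OF x(2) xy(2)] x(1) xy(1) by blast+
qed

lemma is_pair_below:
  assumes "is_pair U q x y" "q \<in> below U h i"
  shows "x \<in> below U h (Suc (Suc i))" "y \<in> below U h (Suc (Suc i))"
proof -
  obtain s t where "elts U q = {s, t}" "elts U t = {x, y}"
    using assms(1) by (auto simp: is_pair_def)
  then show "x \<in> below U h (Suc (Suc i))" "y \<in> below U h (Suc (Suc i))"
    using elts_below[OF _ elts_below[OF _ assms(2)], of _ t] by auto
qed

text \<open>The right side is bounded, which makes pairs expressible by a formula. Conversely,
  extensionality leaves only two possible members of \<open>q\<close>.\<close>

lemma is_pair_upair: "is_pair U q x y \<longleftrightarrow>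
  (\<exists>s\<in>elts U q. is_upair U s x x) \<and> (\<exists>t\<in>elts U q. is_upair U t x y) \<and>
  (\<forall>s\<in>elts U q. is_upair U s x x \<or> is_upair U s x y)"
proof
  assume R: "(\<exists>s\<in>elts U q. is_upair U s x x) \<and> (\<exists>t\<in>elts U q. is_upair U t x y) \<and>
    (\<forall>s\<in>elts U q. is_upair U s x x \<or> is_upair U s x y)"
  then obtain s t where st: "s \<in> elts U q" "elts U s = {x}" "t \<in> elts U q" "elts U t = {x, y}"
    by (auto simp: is_upair_def)
  have "r = s \<or> r = t" if "r \<in> elts U q" for r
  proof -
    have "elts U r = {x} \<or> elts U r = {x, y}" using R that by (auto simp: is_upair_def)
    then show ?thesis using extensional'[of r s] extensional'[of r t] st by auto
  qed
  then have "elts U q = {s, t}" using st by blast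
  with st show "is_pair U q x y" by (auto simp: is_pair_def)
next
  assume "is_pair U q x y"
  then obtain s t where "elts U q = {s, t}" "elts U s = {x}" "elts U t = {x, y}"
    by (auto simp: is_pair_def)
  then show "(\<exists>s\<in>elts U q. is_upair U s x x) \<and> (\<exists>t\<in>elts U q. is_upair U t x y) \<and>
    (\<forall>s\<in>elts U q. is_upair U s x x \<or> is_upair U s x y)"
    by (simp add: is_upair_def)
qed

lemma sat_Pair_form [simp]:
  "s \<noteq> x \<Longrightarrow> s \<noteq> y \<Longrightarrow> w \<noteq> x \<Longrightarrow> w \<noteq> y \<Longrightarrow> w \<noteq> s \<Longrightarrow>
   sat U (Pair_form s w q x y) v \<longleftrightarrow> is_pair U (v q) (v x) (v y)"
  by (auto simp: Pair_form_def is_pair_upair)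

lemma sat_Rel_form [simp]:
  "s \<noteq> x \<Longrightarrow> s \<noteq> y \<Longrightarrow> w \<noteq> x \<Longrightarrow> w \<noteq> y \<Longrightarrow> w \<noteq> s \<Longrightarrow> q \<noteq> x \<Longrightarrow> q \<noteq> y \<Longrightarrow>
   sat U (Rel_form s w q r x y) v \<longleftrightarrow> related U (v r) (v x) (v y)"
  by (simp add: Rel_form_def related_def)

lemma sat_Op_form [simp]:
  "s \<notin> {q, t, c, x, y, z} \<Longrightarrow> w \<notin> {q, t, c, x, y, z} \<Longrightarrow> w \<noteq> s \<Longrightarrow>
   {q, t, c} \<inter> {x, y, z} = {} \<Longrightarrow> distinct [q, t, c] \<Longrightarrow>
   sat U (Op_form s w q t c F x y z) v \<longleftrightarrow> op_related U (v F) (v x) (v y) (v z)"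
  by (simp add: Op_form_def op_related_def)

end

section \<open>Function application and junk values\<close>

declare level.simps(2) [simp del]

definition fun_graph :: "'u universe \<Rightarrow> 'u \<Rightarrow> bool" where
  "fun_graph U F \<longleftrightarrow>
     (\<forall>q\<in>elts U F. \<exists>c d. is_pair U q c d) \<and>
     (\<forall>q\<in>elts U F. \<forall>q'\<in>elts U F. \<forall>c d d'. is_pair U q c d \<longrightarrow> is_pair U q' c d' \<longrightarrow> d = d')"

text \<open>The arguments \<open>c\<close> for which \<open>{{c}, junk}\<close> can pass for a pair
  \<open>(c, d)\<close>. There are at most two, since then \<open>junk\<close> has the form
  \<open>{c, d}\<close>.\<close>

definition bad :: "'u universe \<Rightarrow> 'u set" where
  "bad U = {c. \<exists>d. is_upair U junk c d}"

lemma finite_bad: "finite (bad U)"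
proof (cases "bad U = {}")
  case False
  then obtain c d where "elts U junk = {c, d}" by (auto simp: bad_def is_upair_def)
  then have "bad U \<subseteq> {c, d}" by (auto simp: bad_def is_upair_def)
  then show ?thesis by (rule finite_subset) simp
qed simp

text \<open>What \<open>app\<close> returns where the true value is \<open>v\<close>. If
  \<open>junk\<close> lies in the graph, every \<open>y\<close> that belongs to some set but to no
  member of a set competes with \<open>v\<close>. The formula depends on \<open>v\<close> and
  \<open>F\<close>, not on the argument.\<close>

definition junk_value :: "'u universe \<Rightarrow> enat \<Rightarrow> 'u \<Rightarrow> 'u \<Rightarrow> 'u" where
  "junk_value U h F v = (THE y. y = v \<or> y \<in> below U h 1 \<and> y \<notin> below U h 2 \<and> junk \<in> elts U F)"

context superstr
begin

lemma is_pair_imp_upair: "is_pair U q c d \<Longrightarrow> \<exists>t\<in>elts U q. c \<in> elts U t \<and> d \<in> elts U t"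
  unfolding is_pair_def by auto

lemma is_pair_level:
  assumes "x \<in> level U k" "y \<in> level U k" "enat (k + 2) \<le> h"
  shows "is_pair U (pair U x y) x y" "pair U x y \<in> level U (k + 2)"
proof -
  have h: "enat (Suc k) \<le> h" "enat (Suc (Suc k)) \<le> h"
    using assms(3) order_trans[of "enat (Suc k)" "enat (k + 2)" h] by simp_all
  have s: "{x} \<subseteq> level U k" "{x, y} \<subseteq> level U k" using assms by auto
  have p: "{set_of U {x}, set_of U {x, y}} \<subseteq> level U (Suc k)"
    using set_of_level[OF s(1) h(1)] set_of_level[OF s(2) h(1)] by simp
  show "is_pair U (pair U x y) x y"
    unfolding is_pair_def pair_def
    using elts_set_of[OF s(1) h(1)] elts_set_of[OF s(2) h(1)] elts_set_of[OF p h(2)] by blast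
  show "pair U x y \<in> level U (k + 2)"
    using set_of_level[OF p h(2)] by (simp add: pair_def )
qed

text \<open>
  If \<open>{c, y}\<close> exists but \<open>{{c}, {c, y}}\<close> does not, then \<open>pair U c y\<close> is the junk object; whether this
  happens does not depend on \<open>c\<close>.  If \<open>{c, y}\<close> does not exist, then \<open>pair U c y\<close> is \<open>{{c}, junk}\<close>,
  which is a genuine pair only if \<open>junk = {c, d}\<close> for some \<open>d\<close>.
\<close>

lemma mem_pair_iff:
  assumes F: "fun_graph U F" and q: "q \<in> elts U F" "is_pair U q c v" and c: "c \<notin> bad U"
  shows "mem U (pair U c y) F \<longleftrightarrow>
    y = v \<or> y \<in> below U h 1 \<and> y \<notin> below U h 2 \<and> junk \<in> elts U F"
proof -
  have F1: "x \<in> below U h 1" if "x \<in> elts U F" for x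
    using elts_below[OF that, of 0] by simp
  have cv: "c \<in> below U h 3" "v \<in> below U h 3"
    using is_pair_below[OF q(2) F1[OF q(1)]] by (simp_all add: numeral_3_eq_3)
  have c12: "c \<in> below U h 1" "c \<in> below U h 2" "v \<in> below U h 2"
    using cv below_mono[of 1 3] below_mono[of 2 3] by auto
  consider "y \<in> below U h 2" | "y \<notin> below U h 2" "y \<in> below U h 1" | "y \<notin> below U h 1" by blast
  then show ?thesis
  proof cases
    case 1
    have "is_pair U (pair U c y) c y"
      using is_pair_pair(1)[of c 0 y] 1 c12 by (simp add: numeral_2_eq_2)
    moreover have "pair U c v = q" by (rule is_pair_eq[OF q(2)])
    ultimately show ?thesis using F q 1 unfolding fun_graph_def elts_def by auto
  next
    case 2
    have t: "elts U (set_of U {c, y}) = {c, y}"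
      using set_of_pair_below(1)[of c 0 y] 2 c12 by simp
    have "pair U c y = junk"
      unfolding pair_def
    proof (rule set_of_none)
      fix x show "elts U x \<noteq> {set_of U {c}, set_of U {c, y}}"
      proof
        assume "elts U x = {set_of U {c}, set_of U {c, y}}"
        then have "set_of U {c, y} \<in> below U h 1" using elts_below[of _ x 0] by simp
        then have "y \<in> below U h 2" using elts_below[of y "set_of U {c, y}" 1] t by (simp add: numeral_2_eq_2)
        with 2 show False by simp
      qed
    qed
    moreover have "y \<noteq> v" using 2 c12 by auto
    ultimately show ?thesis using 2 by (auto simp: elts_def)
  next
    case 3
    have "set_of U {c, y} = junk"
    proof (rule set_of_none)
      fix x show "elts U x \<noteq> {c, y}" using elts_below[of y x 0] 3 by auto
    qed
    then have z: "pair U c y = set_of U {set_of U {c}, junk}" by (simp add: pair_def)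
    have s: "elts U (set_of U {c}) = {c}" "set_of U {c} \<in> below U h 1"
      using set_of_pair_below[of c 1 c] c12 by (simp_all add: numeral_2_eq_2)
    have "pair U c y \<notin> elts U F"
    proof
      assume m: "pair U c y \<in> elts U F"
      \<comment> \<open>If no set contained \<open>junk\<close>, then \<open>{{c}, junk}\<close>
        would be missing too, and \<open>pair U c y\<close> would be \<open>junk\<close> itself,
        which is a member of \<open>F\<close>.\<close>
      have "junk \<in> below U h 1"
      proof (rule ccontr)
        assume n: "junk \<notin> below U h 1"
        have "pair U c y = junk" unfolding z
        proof (rule set_of_none)
          fix x show "elts U x \<noteq> {set_of U {c}, junk}" using elts_below[of junk x 0] n by auto
        qed
        with n F1[OF m] show False by simp
      qed
      then have e: "elts U (pair U c y) = {set_of U {c}, junk}"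
        unfolding z using set_of_pair_below(1)[of "set_of U {c}" 0 junk] s by simp
      obtain c' d' where "is_pair U (pair U c y) c' d'"
        using F m unfolding fun_graph_def by blast
      then obtain s' t' where "{set_of U {c}, junk} = {s', t'}" "elts U s' = {c'}" "elts U t' = {c', d'}"
        unfolding is_pair_def e by blast
      \<comment> \<open>Of the two members, \<open>{c}\<close> can play either role in the pair; in
        both cases \<open>junk\<close> has the form \<open>{c, d}\<close>.\<close>
      then have "\<exists>d. elts U junk = {c, d}" using s(1)
        by (auto simp: doubleton_eq_iff)
      then show False using c by (simp add: bad_def is_upair_def)
    qed
    moreover have "y \<noteq> v" using 3 cv below_mono[of 1 3] by auto
    ultimately show ?thesis using 3 by (simp add: elts_def)
  qed
qed

lemma app_eq_junk_value:
  assumes "fun_graph U F" "q \<in> elts U F" "is_pair U q c v" "c \<notin> bad U"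
  shows "app U F c = junk_value U h F v"
  unfolding app_def junk_value_def by (simp only: mem_pair_iff[OF assms])

text \<open>Both components of a pair lie in a common member of it, so the quantifiers over
  components can be bounded and functionality transfers.\<close>

lemma fun_graph_bounded: "fun_graph U F \<longleftrightarrow>
  (\<forall>q\<in>elts U F. (\<exists>t\<in>elts U q. \<exists>c\<in>elts U t. \<exists>d\<in>elts U t. is_pair U q c d) \<and>
    (\<forall>q'\<in>elts U F. \<forall>t\<in>elts U q. \<forall>c\<in>elts U t. \<forall>d\<in>elts U t. \<forall>t'\<in>elts U q'. \<forall>d'\<in>elts U t'.
      \<not> (is_pair U q c d \<and> is_pair U q' c d' \<and> d \<noteq> d')))" (is "_ \<longleftrightarrow> ?R")
proof
  assume F: "fun_graph U F"
  show ?R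
  proof (intro ballI conjI)
    fix q assume "q \<in> elts U F"
    then obtain c d where "is_pair U q c d" using F unfolding fun_graph_def by blast
    with is_pair_imp_upair[OF this] show "\<exists>t\<in>elts U q. \<exists>c\<in>elts U t. \<exists>d\<in>elts U t. is_pair U q c d"
      by blast
  qed (use F in \<open>unfold fun_graph_def, blast\<close>)
next
  assume R: ?R
  show "fun_graph U F"
    unfolding fun_graph_def
  proof (intro conjI ballI allI impI)
    fix q q' c d d' assume a: "q \<in> elts U F" "q' \<in> elts U F" "is_pair U q c d" "is_pair U q' c d'"
    obtain t where t: "t \<in> elts U q" "c \<in> elts U t" "d \<in> elts U t"
      using is_pair_imp_upair[OF a(3)] by blast
    obtain t' where t': "t' \<in> elts U q'" "d' \<in> elts U t'"
      using is_pair_imp_upair[OF a(4)] by blast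
    have "\<not> (is_pair U q c d \<and> is_pair U q' c d' \<and> d \<noteq> d')"
      using conjunct2[OF bspec[OF R a(1)]] a(2) t t' by simp
    with a show "d = d'" by simp
  next
    fix q assume "q \<in> elts U F"
    from conjunct1[OF bspec[OF R this]] show "\<exists>c d. is_pair U q c d" by blast
  qed
qed

end

section \<open>Standard graphs and their transfer\<close>

definition op_graph :: "'u universe \<Rightarrow> ('a \<Rightarrow> 'u) \<Rightarrow> ('b \<Rightarrow> 'u) \<Rightarrow> ('c \<Rightarrow> 'u) \<Rightarrow> ('a \<Rightarrow> 'b \<Rightarrow> 'c) \<Rightarrow> 'u" where
  "op_graph U ca cb cc f = set_of U {pair U (pair U (ca x) (cb y)) (cc (f x y)) |x y. True}"

definition rel_graph :: "'u universe \<Rightarrow> ('a \<Rightarrow> 'u) \<Rightarrow> ('b \<Rightarrow> 'u) \<Rightarrow> ('a \<Rightarrow> 'b \<Rightarrow> bool) \<Rightarrow> 'u" where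
  "rel_graph U ca cb R = set_of U {pair U (ca x) (cb y) |x y. R x y}"

locale enlargement =
  fixes N :: "('v, 'w, 'e) nsa" and h :: enat and n :: nat
  assumes enlargement: "polysaturated_enlargement N h"
    and height: "enat (n + 5) \<le> h"
    and codes: "range (rcode N) \<subseteq> level (std N) n" "range (ecode N) \<subseteq> level (std N) n"
begin

abbreviation V where "V \<equiv> std N"
abbreviation W where "W \<equiv> nst N"

sublocale S: superstr V h
  using enlargement by unfold_locales (simp add: polysaturated_enlargement_def)

sublocale T: superstr W h
  using enlargement by unfold_locales (simp add: polysaturated_enlargement_def)

lemma inj_codes: "inj (rcode N)" "inj (ecode N)"
  using enlargement by (simp_all add: polysaturated_enlargement_def)

text \<open>The list supplies the constants: variable \<open>i\<close> denotes
  \<open>xs ! i\<close>. Indices beyond the list are used for bound variables.\<close>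

lemma transfer: "sat V \<phi> (\<lambda>i. xs ! i) \<longleftrightarrow> sat W \<phi> (\<lambda>i. star N (xs ! i))"
  using enlargement unfolding polysaturated_enlargement_def transfer_principle_def
  by (simp add: comp_def)

lemma star_mem [simp]: "mem W (star N x) (star N y) \<longleftrightarrow> mem V x y"
  using transfer[of "Mem 0 1" "[x, y]"] by simp

lemma star_eq [simp]: "star N x = star N y \<longleftrightarrow> x = y"
  using transfer[of "Eq 0 1" "[x, y]"] by simp

lemma star_elts [simp]: "star N x \<in> elts W (star N y) \<longleftrightarrow> x \<in> elts V y"
  by (simp add: elts_def)

lemma star_is_pair [simp]: "is_pair W (star N q) (star N x) (star N y) \<longleftrightarrow> is_pair V q x y"
  using transfer[of "Pair_form 3 4 0 1 2" "[q, x, y]"] by simp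

lemma star_fun_graph: "fun_graph W (star N F) \<longleftrightarrow> fun_graph V F"
  \<comment> \<open>Variables 1 and 5 are the pairs \<open>q\<close>, \<open>q'\<close>, variables 2
    and 6 their members \<open>t\<close>, \<open>t'\<close>, and 3, 4, 7 the components
    \<open>c\<close>, \<open>d\<close>, \<open>d'\<close>.\<close>
  using transfer[of "BAll 1 0 (Conj
     (BEx 2 1 (BEx 3 2 (BEx 4 2 (Pair_form 10 11 1 3 4))))
     (BAll 5 0 (BAll 2 1 (BAll 3 2 (BAll 4 2 (BAll 6 5 (BAll 7 6
        (Neg (Conj (Pair_form 10 11 1 3 4) (Conj (Pair_form 10 11 5 3 7) (Neg (Eq 4 7))))))))))))" "[F]"]
  by (simp add: S.fun_graph_bounded T.fun_graph_bounded)

definition coding :: "('a \<Rightarrow> 'v) \<Rightarrow> bool" where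
  "coding c \<longleftrightarrow> inj c \<and> range c \<subseteq> level V n"

lemma coding_codes: "coding (rcode N)" "coding (ecode N)"
  using codes inj_codes by (simp_all add: coding_def)

lemma coding_level: "coding c \<Longrightarrow> n \<le> k \<Longrightarrow> c x \<in> level V k"
  using S.level_mono[of n k] by (auto simp: coding_def)

lemma height_le: "k \<le> n + 5 \<Longrightarrow> enat k \<le> h"
  using height order_trans[of "enat k" "enat (n + 5)" h] by simp

text \<open>Codes have level \<open>n\<close>, argument pairs \<open>n + 2\<close>, graph entries
  \<open>n + 4\<close> and the graph \<open>n + 5\<close>, exactly the room that the height
  provides.\<close>

lemma elts_op_graph:
  assumes "coding ca" "coding cb" "coding cc"
  shows "elts V (op_graph V ca cb cc f) = {pair V (pair V (ca x) (cb y)) (cc (f x y)) |x y. True}"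
    and "is_pair V (pair V (ca x) (cb y)) (ca x) (cb y)"
    and "is_pair V (pair V (pair V (ca x) (cb y)) (cc z)) (pair V (ca x) (cb y)) (cc z)"
proof -
  have 1: "is_pair V (pair V (ca x) (cb y)) (ca x) (cb y)" "pair V (ca x) (cb y) \<in> level V (n + 2)" for x y
    using S.is_pair_level[of "ca x" n "cb y"] coding_level[OF assms(1), of n] coding_level[OF assms(2), of n]
      height_le[of "n + 2"] by simp_all
  have 2: "is_pair V (pair V (pair V (ca x) (cb y)) (cc z)) (pair V (ca x) (cb y)) (cc z)"
      "pair V (pair V (ca x) (cb y)) (cc z) \<in> level V (n + 4)" for x y z
    using S.is_pair_level[of "pair V (ca x) (cb y)" "n + 2" "cc z"] 1 coding_level[OF assms(3), of "n + 2"]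
      height_le[of "n + 4"] by (simp_all add: numeral_eq_Suc)
  show "is_pair V (pair V (ca x) (cb y)) (ca x) (cb y)"
    "is_pair V (pair V (pair V (ca x) (cb y)) (cc z)) (pair V (ca x) (cb y)) (cc z)"
    by (fact 1 2)+
  show "elts V (op_graph V ca cb cc f) = {pair V (pair V (ca x) (cb y)) (cc (f x y)) |x y. True}"
    unfolding op_graph_def
    by (rule S.elts_set_of[of _ "n + 4"]) (use 2 in \<open>auto simp: height_le\<close>)
qed

lemma elts_rel_graph:
  assumes "coding ca" "coding cb"
  shows "elts V (rel_graph V ca cb R) = {pair V (ca x) (cb y) |x y. R x y}"
  unfolding rel_graph_def
proof (rule S.elts_set_of[of _ "n + 2"])
  show "{pair V (ca x) (cb y) |x y. R x y} \<subseteq> level V (n + 2)"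
    using S.is_pair_level(2)[of _ n] coding_level[OF assms(1), of n] coding_level[OF assms(2), of n]
      height_le[of "n + 2"] by auto
qed (simp add: height_le)

lemma elts_range: "coding c \<Longrightarrow> elts V (set_of V (range c)) = range c"
  using S.elts_set_of[of "range c" n] height_le[of "Suc n"] by (simp add: coding_def)

lemma fun_graph_op:
  assumes "coding ca" "coding cb" "coding cc"
  shows "fun_graph V (op_graph V ca cb cc f)"
  unfolding fun_graph_def elts_op_graph(1)[OF assms]
proof (intro conjI ballI allI impI)
  fix q q' c d d'
  assume "q \<in> {pair V (pair V (ca x) (cb y)) (cc (f x y)) |x y. True}"
    "q' \<in> {pair V (pair V (ca x) (cb y)) (cc (f x y)) |x y. True}"
    and p: "is_pair V q c d" "is_pair V q' c d'"
  then obtain x y x' y' where q: "q = pair V (pair V (ca x) (cb y)) (cc (f x y))"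
    "q' = pair V (pair V (ca x') (cb y')) (cc (f x' y'))" by blast
  have c: "pair V (ca x) (cb y) = c \<and> cc (f x y) = d" "pair V (ca x') (cb y') = c \<and> cc (f x' y') = d'"
    using is_pair_inject[OF elts_op_graph(3)[OF assms] p(1)[unfolded q]]
      is_pair_inject[OF elts_op_graph(3)[OF assms] p(2)[unfolded q]] .
  then have "ca x = ca x' \<and> cb y = cb y'"
    using is_pair_inject[OF elts_op_graph(2)[OF assms, of x y], of "ca x'" "cb y'"]
      elts_op_graph(2)[OF assms, of x' y'] by simp
  then have "x = x'" "y = y'" using assms by (auto simp: coding_def inj_def)
  with c show "d = d'" by simp
qed (use elts_op_graph(3)[OF assms] in blast)

lemma star_op_app2: "star_op N ca cb cc f a b = app W (star N (op_graph V ca cb cc f)) (pair W a b)"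
  by (simp add: star_op_def op_graph_def app2_def)

text \<open>The hypotheses name actual pairs \<open>c = (a, b)\<close> and
  \<open>q = (c, v)\<close>. An existing pair agrees with \<open>pair\<close>, so only the search
  for the value can meet junk.\<close>

lemma star_op_eq_junk_value:
  assumes "coding ca" "coding cb" "coding cc"
    and "q \<in> elts W (star N (op_graph V ca cb cc f))" "is_pair W q c v" "is_pair W c a b" "c \<notin> bad W"
  shows "star_op N ca cb cc f a b = junk_value W h (star N (op_graph V ca cb cc f)) v"
  unfolding star_op_app2 T.is_pair_eq[OF assms(6)]
  by (rule T.app_eq_junk_value) (use assms fun_graph_op star_fun_graph in auto)

text \<open>Distinct standard arguments have distinct starred pairs, so only finitely many fall into
  the finite set \<open>bad W\<close>. One and the same function of the true value describes the
  operation at all others.\<close>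

lemma star_op_standard:
  fixes ca :: "'a \<Rightarrow> 'v" and cb :: "'b \<Rightarrow> 'v" and cc :: "'c \<Rightarrow> 'v"
  assumes "coding ca" "coding cb" "coding cc"
  obtains D where "finite D"
    "\<And>x y. (x, y) \<notin> D \<Longrightarrow> star_op N ca cb cc f (star N (ca x)) (star N (cb y)) =
       junk_value W h (star N (op_graph V ca cb cc f)) (star N (cc (f x y)))"
proof
  define D where "D = {(x, y). star N (pair V (ca x) (cb y)) \<in> bad W}"
  have "inj (\<lambda>(x, y). star N (pair V (ca x) (cb y)))"
  proof (rule injI, clarsimp)
    fix x y x' y' assume "pair V (ca x) (cb y) = pair V (ca x') (cb y')"
    then have "ca x = ca x' \<and> cb y = cb y'"
      using is_pair_inject[OF elts_op_graph(2)[OF assms, of x y], of "ca x'" "cb y'"]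
        elts_op_graph(2)[OF assms, of x' y'] by simp
    then show "x = x' \<and> y = y'" using assms by (auto simp: coding_def inj_def)
  qed
  then have "finite ((\<lambda>(x, y). star N (pair V (ca x) (cb y))) -` bad W)"
    by (rule finite_vimageI[OF finite_bad])
  also have "(\<lambda>(x, y). star N (pair V (ca x) (cb y))) -` bad W = D" by (auto simp: D_def)
  finally show "finite D" .
  fix x y assume "(x, y) \<notin> D"
  then have nb: "star N (pair V (ca x) (cb y)) \<notin> bad W" by (simp add: D_def)
  show "star_op N ca cb cc f (star N (ca x)) (star N (cb y)) =
       junk_value W h (star N (op_graph V ca cb cc f)) (star N (cc (f x y)))"
  proof (rule star_op_eq_junk_value[OF assms _ _ _ nb])
    let ?c = "pair V (ca x) (cb y)" let ?q = "pair V ?c (cc (f x y))"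
    show "star N ?q \<in> elts W (star N (op_graph V ca cb cc f))"
      using elts_op_graph(1)[OF assms, of f] by auto
  qed (simp_all add: elts_op_graph(2,3)[OF assms])
qed

text \<open>Unlike for operations, there is no exceptional set: elements of a starred code set are
  low enough for their pair to exist.\<close>

lemma star_rel_iff:
  assumes "coding ca" "coding cb" "a \<in> star_set N (range ca)" "b \<in> star_set N (range cb)"
  shows "star_rel N ca cb R a b \<longleftrightarrow> related W (star N (rel_graph V ca cb R)) a b"
proof -
  \<comment> \<open>The star of the singleton of \<open>?R\<close> contains the star of
    \<open>?R\<close>, which contains \<open>x\<close>; this puts \<open>x\<close> two levels below
    the top.\<close>
  have *: "x \<in> below W h 2" if x: "x \<in> star_set N (range c)" and c: "coding c" for x :: 'w and c :: "'z \<Rightarrow> 'v"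
  proof -
    let ?R = "set_of V (range c)"
    have "?R \<in> level V (Suc n)"
      using S.set_of_level[of "range c" n] height_le[of "Suc n"] c by (simp add: coding_def)
    then have "?R \<in> elts V (set_of V {?R})"
      using S.elts_set_of[of "{?R}" "Suc n"] height_le[of "Suc (Suc n)"] by simp
    then have "star N ?R \<in> elts W (star N (set_of V {?R}))" by simp
    then have "star N ?R \<in> below W h 1"
      using T.elts_below[of "star N ?R" "star N (set_of V {?R})" 0] by simp
    then show ?thesis using T.elts_below[of x "star N ?R" 1] x by (simp add: star_set_def numeral_2_eq_2)
  qed
  have p: "is_pair W (pair W a b) a b"
    using T.is_pair_pair(1)[of a 0 b] *[OF assms(3,1)] *[OF assms(4,2)] by (simp add: numeral_2_eq_2)
  have "related W F a b \<longleftrightarrow> mem W (pair W a b) F" for F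
    using p T.is_pair_eq[of _ a b] unfolding related_def elts_def by blast
  then show ?thesis by (simp add: star_rel_def holds_rel_def rel_graph_def)
qed

lemma star_in_star_set [simp]: "coding c \<Longrightarrow> star N (c x) \<in> star_set N (range c)"
  by (simp add: star_set_def elts_range)

lemma rel_graph_iff:
  assumes "coding ca" "coding cb"
  shows "related V (rel_graph V ca cb R) (ca x) (cb y) \<longleftrightarrow> R x y"
proof
  assume "related V (rel_graph V ca cb R) (ca x) (cb y)"
  then obtain x' y' where "is_pair V (pair V (ca x') (cb y')) (ca x) (cb y)" "R x' y'"
    by (auto simp: related_def elts_rel_graph[OF assms])
  then show "R x y"
    using is_pair_inject[OF elts_op_graph(2)[OF assms assms(2), of x' y'], of "ca x" "cb y"]
      assms by (simp add: coding_def inj_eq)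
next
  assume "R x y"
  then show "related V (rel_graph V ca cb R) (ca x) (cb y)"
    using elts_op_graph(2)[OF assms assms(2), of x y] by (auto simp: related_def elts_rel_graph[OF assms])
qed

lemma star_rel_standard [simp]:
  assumes "coding ca" "coding cb"
  shows "star_rel N ca cb R (star N (ca x)) (star N (cb y)) \<longleftrightarrow> R x y"
proof -
  have "star_rel N ca cb R (star N (ca x)) (star N (cb y)) \<longleftrightarrow>
    related V (rel_graph V ca cb R) (ca x) (cb y)"
    using transfer[of "Rel_form 4 5 3 0 1 2" "[rel_graph V ca cb R, ca x, cb y]"] assms
    by (simp add: star_rel_iff)
  also note rel_graph_iff[OF assms]
  finally show ?thesis .
qed

end

section \<open>Standard elements of the hyperreals and of the norming lattice\<close>

text \<open>Off \<open>D\<close> the sum is an unknown function \<open>g\<close> of the true sum,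
  and adding zero shows \<open>g d = e d\<close> off \<open>D\<close>. For arbitrary
  \<open>x\<close>, \<open>y\<close>, associativity with a generic third summand \<open>t\<close>
  uses unexceptional sums only, and \<open>e t\<close> cancels.\<close>

lemma embedding_additive:
  fixes G (structure) and e :: "'a :: real_vector \<Rightarrow> 'g"
  assumes "abelian_group G" and e: "\<And>x. e x \<in> carrier G" "e 0 = \<zero>"
    and D: "finite D" "\<And>x y. (x, y) \<notin> D \<Longrightarrow> e x \<oplus> e y = g (x + y)"
  shows "e (x + y) = e x \<oplus> e y"
proof -
  interpret abelian_group G by fact
  have g: "g d = e d" if "(d, 0) \<notin> D" for d
    using D(2)[OF that] e by (metis r_zero add.right_neutral)
  show ?thesis
  proof (cases "\<exists>z :: 'a. z \<noteq> 0")
    case False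
    then have "x = 0" "y = 0" by auto
    then show ?thesis using e by (metis r_zero add.right_neutral)
  next
    case True
    then obtain z :: 'a where z: "z \<noteq> 0" by blast
    \<comment> \<open>The five ways in which \<open>t\<close> could meet the exceptional set; each
      excludes finitely many \<open>t\<close>, while the line through \<open>z\<close> is
      infinite.\<close>
    define B where "B = (\<lambda>t. (y, t)) -` D \<union> (\<lambda>t. (x, y + t)) -` D \<union> (\<lambda>t. (x + y, t)) -` D \<union>
      (\<lambda>t. (y + t, 0)) -` D \<union> (\<lambda>t. (x + y + t, 0)) -` D"
    have "finite B" unfolding B_def
      by (intro finite_UnI finite_vimageI D(1)) (auto simp: inj_def)
    moreover have "infinite (range (\<lambda>r. r *\<^sub>R z))"
      using z by (subst finite_image_iff) (auto simp: inj_def infinite_UNIV_char_0)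
    ultimately obtain t where "t \<notin> B" by (meson finite_subset subsetI)
    then have t: "(y, t) \<notin> D" "(x, y + t) \<notin> D" "(x + y, t) \<notin> D" "(y + t, 0) \<notin> D" "(x + y + t, 0) \<notin> D"
      by (auto simp: B_def)
    have "e x \<oplus> e y \<oplus> e t = e x \<oplus> (e y \<oplus> e t)" using e by (simp add: a_assoc)
    also have "\<dots> = e x \<oplus> e (y + t)" using t D(2) g by simp
    also have "\<dots> = e (x + y + t)" using t D(2) g by (simp add: add.assoc)
    also have "\<dots> = e (x + y) \<oplus> e t" using t D(2) g by simp
    finally show ?thesis using e by simp
  qed
qed

text \<open>The unit law identifies \<open>g\<close> with \<open>e\<close> off \<open>D\<close>;
  splitting \<open>a\<close> as \<open>(a - t) + t\<close> with generic \<open>t\<close> then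
  reduces every product to unexceptional ones.\<close>

lemma embedding_scales:
  fixes G (structure) and e :: "'a :: real_vector \<Rightarrow> 'g" and s :: "real \<Rightarrow> 'a \<Rightarrow> 'g"
  assumes e: "\<And>x y. e (x + y) = e x \<oplus> e y"
    and s: "\<And>a b x. s (a + b) x = s a x \<oplus> s b x" "\<And>x. s 1 x = e x" "\<And>a. s a 0 = e 0"
    and D: "finite D" "\<And>a x. (a, x) \<notin> D \<Longrightarrow> s a x = g (a *\<^sub>R x)"
  shows "s a x = e (a *\<^sub>R x)"
proof (cases "x = 0")
  case True
  then show ?thesis using s by simp
next
  case False
  have good: "s a x = e (a *\<^sub>R x)" if "(a, x) \<notin> D" "(1, a *\<^sub>R x) \<notin> D" for a
    using D(2)[OF that(1)] D(2)[OF that(2)] s(2) by simp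
  define B where "B = (\<lambda>t. (t, x)) -` D \<union> (\<lambda>t. (a - t, x)) -` D \<union>
    (\<lambda>t. (1, t *\<^sub>R x)) -` D \<union> (\<lambda>t. (1, (a - t) *\<^sub>R x)) -` D"
  have "finite B" unfolding B_def using False
    by (intro finite_UnI finite_vimageI D(1)) (auto simp: inj_def)
  then obtain t where "t \<notin> B" using ex_new_if_finite[OF infinite_UNIV_char_0] by blast
  then have t: "(t, x) \<notin> D" "(a - t, x) \<notin> D" "(1, t *\<^sub>R x) \<notin> D" "(1, (a - t) *\<^sub>R x) \<notin> D"
    by (auto simp: B_def)
  have "s a x = s (a - t) x \<oplus> s t x" using s(1)[of "a - t" t x] by simp
  also have "\<dots> = e ((a - t) *\<^sub>R x + t *\<^sub>R x)" using t good e by simp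
  finally show ?thesis by (simp flip: scaleR_left_distrib)
qed

section \<open>Order arithmetic in ordered vector spaces\<close>

locale ovs =
  fixes K :: "'k oring" and X :: "('k, 'x) omodule"
  assumes ovs: "ordered_vector_space K X"
begin

lemmas ovsD = ovs[unfolded ordered_vector_space_def]

sublocale Module.module K X using ovsD by blast

sublocale K: field K using ovsD by blast

lemma le_refl: "x \<in> carrier X \<Longrightarrow> vle X x x"
  using ovsD by blast

lemma le_trans:
  "x \<in> carrier X \<Longrightarrow> y \<in> carrier X \<Longrightarrow> z \<in> carrier X \<Longrightarrow> vle X x y \<Longrightarrow> vle X y z \<Longrightarrow> vle X x z"
  using ovsD by blast

lemma add_right_mono:
  "x \<in> carrier X \<Longrightarrow> y \<in> carrier X \<Longrightarrow> z \<in> carrier X \<Longrightarrow> vle X x y \<Longrightarrow> vle X (x \<oplus>\<^bsub>X\<^esub> z) (y \<oplus>\<^bsub>X\<^esub> z)"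
  using ovsD by blast

lemma smult_mono:
  "a \<in> carrier K \<Longrightarrow> x \<in> carrier X \<Longrightarrow> y \<in> carrier X \<Longrightarrow> sle K \<zero>\<^bsub>K\<^esub> a \<Longrightarrow> vle X x y \<Longrightarrow>
   vle X (a \<odot>\<^bsub>X\<^esub> x) (a \<odot>\<^bsub>X\<^esub> y)"
  using ovsD by blast

lemma add_mono:
  assumes "x \<in> carrier X" "y \<in> carrier X" "x' \<in> carrier X" "y' \<in> carrier X" "vle X x x'" "vle X y y'"
  shows "vle X (x \<oplus>\<^bsub>X\<^esub> y) (x' \<oplus>\<^bsub>X\<^esub> y')"
  using add_right_mono[of x x' y] add_right_mono[of y y' x'] assms
    le_trans[of "x \<oplus>\<^bsub>X\<^esub> y" "x' \<oplus>\<^bsub>X\<^esub> y" "x' \<oplus>\<^bsub>X\<^esub> y'"]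
  by (simp add: a_comm)

lemma add_nonneg: "x \<in> carrier X \<Longrightarrow> y \<in> carrier X \<Longrightarrow> vle X \<zero>\<^bsub>X\<^esub> x \<Longrightarrow> vle X \<zero>\<^bsub>X\<^esub> y \<Longrightarrow> vle X \<zero>\<^bsub>X\<^esub> (x \<oplus>\<^bsub>X\<^esub> y)"
  using add_mono[of "\<zero>\<^bsub>X\<^esub>" "\<zero>\<^bsub>X\<^esub>" x y] by simp

lemma le_add_nonneg: "x \<in> carrier X \<Longrightarrow> y \<in> carrier X \<Longrightarrow> vle X \<zero>\<^bsub>X\<^esub> y \<Longrightarrow> vle X x (x \<oplus>\<^bsub>X\<^esub> y)"
  using add_mono[of x "\<zero>\<^bsub>X\<^esub>" x y] le_refl[of x] by simp

lemma smult_nonneg: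
  "a \<in> carrier K \<Longrightarrow> x \<in> carrier X \<Longrightarrow> sle K \<zero>\<^bsub>K\<^esub> a \<Longrightarrow> vle X \<zero>\<^bsub>X\<^esub> x \<Longrightarrow> vle X \<zero>\<^bsub>X\<^esub> (a \<odot>\<^bsub>X\<^esub> x)"
  using smult_mono[of a "\<zero>\<^bsub>X\<^esub>" x] by simp

end

section \<open>The internal space and the embeddings of standard scalars and vectors\<close>

locale internal_space = enlargement N h n
  for N :: "('v, 'w, 'e :: {ordered_real_vector, conditionally_complete_lattice}) nsa" and h n +
  fixes Y :: "'w int_space" and p :: 'w
  assumes internal_lnovs: "internal_lnovs N Y p"
begin

abbreviation "K \<equiv> hyperreals N"
abbreviation "L \<equiv> star_space N"
abbreviation "X \<equiv> space_of N Y"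
abbreviation "P \<equiv> app (nst N) p"

lemma lnovs: "lnovs K X L P"
  using internal_lnovs by (simp add: internal_lnovs_def Let_def)

sublocale K: field K
  using lnovs by (simp add: lnovs_def ordered_vector_space_def)

sublocale X: ovs K X
  using lnovs by unfold_locales (simp add: lnovs_def)

sublocale L: ovs K L
  using lnovs by unfold_locales (simp add: lnovs_def vector_lattice_def)

abbreviation "\<rho> \<equiv> star_real N"
abbreviation "\<epsilon> \<equiv> star_vec N"

lemma star_carrier [simp]: "\<rho> r \<in> carrier K" "\<epsilon> e \<in> carrier L"
  by (simp_all add: hyperreals_def star_space_def star_real_def star_vec_def coding_codes)

lemma star_zero_one: "\<rho> 0 = \<zero>\<^bsub>K\<^esub>" "\<rho> 1 = \<one>\<^bsub>K\<^esub>" "\<epsilon> 0 = \<zero>\<^bsub>L\<^esub>"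
  by (simp_all add: hyperreals_def star_space_def)

lemma star_le [simp]: "sle K (\<rho> r) (\<rho> s) \<longleftrightarrow> r \<le> s" "vle L (\<epsilon> d) (\<epsilon> e) \<longleftrightarrow> d \<le> e"
  by (simp_all add: hyperreals_def star_space_def star_real_def star_vec_def coding_codes)

lemma star_real_add: "\<rho> (r + s) = \<rho> r \<oplus>\<^bsub>K\<^esub> \<rho> s"
proof -
  obtain D where D: "finite D"
    "\<And>x y. (x, y) \<notin> D \<Longrightarrow> star_op N (rcode N) (rcode N) (rcode N) (+) (star N (rcode N x)) (star N (rcode N y)) =
       junk_value W h (star N (op_graph V (rcode N) (rcode N) (rcode N) (+))) (star N (rcode N (x + y)))"
    using star_op_standard[OF coding_codes(1,1,1)] by blast
  have "add K = star_op N (rcode N) (rcode N) (rcode N) (+)" by (simp add: hyperreals_def)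
  then show ?thesis
    using D by (intro embedding_additive[OF K.abelian_group_axioms _ _ D(1)])
      (auto simp: star_zero_one simp flip: star_real_def)
qed

lemma star_vec_add: "\<epsilon> (d + e) = \<epsilon> d \<oplus>\<^bsub>L\<^esub> \<epsilon> e"
proof -
  obtain D where D: "finite D"
    "\<And>x y. (x, y) \<notin> D \<Longrightarrow> star_op N (ecode N) (ecode N) (ecode N) (+) (star N (ecode N x)) (star N (ecode N y)) =
       junk_value W h (star N (op_graph V (ecode N) (ecode N) (ecode N) (+))) (star N (ecode N (x + y)))"
    using star_op_standard[OF coding_codes(2,2,2)] by blast
  have "add L = star_op N (ecode N) (ecode N) (ecode N) (+)" by (simp add: star_space_def)
  then show ?thesis
    using D by (intro embedding_additive[OF L.abelian_group_axioms _ _ D(1)])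
      (auto simp: star_zero_one simp flip: star_vec_def)
qed

text \<open>The reals are regarded as a vector space over themselves; distributivity and the unit
  law in \<open>K\<close> then settle the exceptional products.\<close>

lemma star_real_mult: "\<rho> (r * s) = \<rho> r \<otimes>\<^bsub>K\<^esub> \<rho> s"
proof -
  obtain D where D: "finite D"
    "\<And>x y. (x, y) \<notin> D \<Longrightarrow> star_op N (rcode N) (rcode N) (rcode N) (*) (star N (rcode N x)) (star N (rcode N y)) =
       junk_value W h (star N (op_graph V (rcode N) (rcode N) (rcode N) (*))) (star N (rcode N (x * y)))"
    using star_op_standard[OF coding_codes(1,1,1)] by blast
  have m: "mult K = star_op N (rcode N) (rcode N) (rcode N) (*)" by (simp add: hyperreals_def)
  note D2 = D(2)[folded m star_real_def]
  have "\<rho> r \<otimes>\<^bsub>K\<^esub> \<rho> s = \<rho> (r *\<^sub>R s)"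
    by (rule embedding_scales[where s = "\<lambda>r s. \<rho> r \<otimes>\<^bsub>K\<^esub> \<rho> s", OF star_real_add _ _ _ D(1)])
      (use D2 in \<open>simp_all add: star_real_add star_zero_one K.l_distr\<close>)
  then show ?thesis by simp
qed

lemma star_vec_smult: "\<epsilon> (r *\<^sub>R e) = \<rho> r \<odot>\<^bsub>L\<^esub> \<epsilon> e"
proof -
  obtain D where D: "finite D"
    "\<And>x y. (x, y) \<notin> D \<Longrightarrow> star_op N (rcode N) (ecode N) (ecode N) scaleR (star N (rcode N x)) (star N (ecode N y)) =
       junk_value W h (star N (op_graph V (rcode N) (ecode N) (ecode N) scaleR)) (star N (ecode N (x *\<^sub>R y)))"
    using star_op_standard[OF coding_codes(1,2,2)] by blast
  have m: "smult L = star_op N (rcode N) (ecode N) (ecode N) scaleR" by (simp add: star_space_def)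
  note D2 = D(2)[folded m star_real_def star_vec_def]
  show ?thesis
    by (rule embedding_scales[where s = "\<lambda>r e. \<rho> r \<odot>\<^bsub>L\<^esub> \<epsilon> e", OF star_vec_add _ _ _ D(1), symmetric])
      (use D2 in \<open>simp_all add: star_real_add star_zero_one L.smult_l_distr\<close>)
qed

section \<open>The order of the hyperreals and the standard part\<close>

lemma sle_iff:
  assumes "a \<in> carrier K" "b \<in> carrier K"
  shows "sle K a b \<longleftrightarrow>
    related W (star N (rel_graph V (rcode N) (rcode N) (\<le>))) a b"
  using star_rel_iff[OF coding_codes(1,1), of a b "(\<le>)"] assms by (simp add: hyperreals_def)

lemma carrier_hyperreals: "carrier K = elts W (star N (set_of V (range (rcode N))))"
  by (simp add: hyperreals_def star_set_def)

lemma hyperreal_order: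
  assumes M: "M \<in> carrier K" and "r \<le> s"
  shows "sle K M (\<rho> r) \<Longrightarrow> sle K M (\<rho> s)" "sle K (\<rho> s) M \<Longrightarrow> sle K (\<rho> r) M"
    "sle K (\<rho> r) M \<or> sle K M (\<rho> r)" "r \<noteq> s \<Longrightarrow> sle K (\<rho> s) M \<Longrightarrow> \<not> sle K M (\<rho> r)"
proof -
  let ?R = "set_of V (range (rcode N))" and ?le = "rel_graph V (rcode N) (rcode N) (\<le>)"
  let ?xs = "[?R, ?le, rcode N r, rcode N s]"
  let ?L = "\<lambda>i j. Rel_form 8 9 7 1 i j"
  \<comment> \<open>Variable 4 ranges over the reals and becomes \<open>M\<close> after transfer;
    variables 2 and 3 are the constants \<open>r\<close> and \<open>s\<close>.\<close>
  let ?\<phi> = "BAll 4 0 (Conj (Disj (Neg (?L 4 2)) (?L 4 3)) (Conj (Disj (Neg (?L 3 4)) (?L 2 4))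
    (Conj (Disj (?L 2 4) (?L 4 2)) (Neg (Conj (Neg (Eq 2 3)) (Conj (?L 3 4) (?L 4 2)))))))"
  have "sat V ?\<phi> (\<lambda>i. ?xs ! i)"
    using assms rel_graph_iff[OF coding_codes(1,1), of "(\<le>)"]
    by (auto simp: elts_range[OF coding_codes(1)] inj_eq[OF inj_codes(1)])
  then have "sat W ?\<phi> (\<lambda>i. star N (?xs ! i))" unfolding transfer .
  then have "(sle K M (\<rho> r) \<longrightarrow> sle K M (\<rho> s)) \<and> (sle K (\<rho> s) M \<longrightarrow> sle K (\<rho> r) M) \<and>
    (sle K (\<rho> r) M \<or> sle K M (\<rho> r)) \<and> (r \<noteq> s \<longrightarrow> sle K (\<rho> s) M \<longrightarrow> \<not> sle K M (\<rho> r))"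
    using M unfolding sle_iff[OF M star_carrier(1)] sle_iff[OF star_carrier(1) M]
    by (auto simp: carrier_hyperreals star_real_def inj_eq[OF inj_codes(1)])
  then show "sle K M (\<rho> r) \<Longrightarrow> sle K M (\<rho> s)" "sle K (\<rho> s) M \<Longrightarrow> sle K (\<rho> r) M"
    "sle K (\<rho> r) M \<or> sle K M (\<rho> r)" "r \<noteq> s \<Longrightarrow> sle K (\<rho> s) M \<Longrightarrow> \<not> sle K M (\<rho> r)" by auto
qed

lemma hyperreal_difference:
  assumes M: "M \<in> carrier K" and le: "sle K M (\<rho> r)"
  shows "\<exists>k\<in>carrier K. sle K \<zero>\<^bsub>K\<^esub> k \<and>
    op_related W (star N (op_graph V (rcode N) (rcode N) (rcode N) (+))) M k (\<rho> r)"
proof -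
  let ?R = "set_of V (range (rcode N))" and ?le = "rel_graph V (rcode N) (rcode N) (\<le>)"
    and ?A = "op_graph V (rcode N) (rcode N) (rcode N) (+)"
  let ?xs = "[?R, ?le, ?A, rcode N r, rcode N 0]"
  let ?L = "\<lambda>i j. Rel_form 14 15 13 1 i j"
  let ?\<phi> = "BAll 5 0 (Disj (Neg (?L 5 3)) (BEx 6 0 (Conj (?L 4 6) (Op_form 14 15 7 8 9 2 5 6 3))))"
  have "op_related V ?A (rcode N m) (rcode N (r - m)) (rcode N r)" for m
  proof -
    let ?c = "pair V (rcode N m) (rcode N (r - m))" let ?q = "pair V ?c (rcode N r)"
    have "?q \<in> elts V ?A" unfolding elts_op_graph(1)[OF coding_codes(1,1,1)]
      by (intro CollectI exI[of _ m] exI[of _ "r - m"]) simp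
    moreover have "is_pair V ?q ?c (rcode N r)" "is_pair V ?c (rcode N m) (rcode N (r - m))"
      using elts_op_graph(2,3)[OF coding_codes(1,1,1)] by auto
    ultimately show ?thesis unfolding op_related_def using S.is_pair_imp_upair by blast
  qed
  then have "sat V ?\<phi> (\<lambda>i. ?xs ! i)"
    using rel_graph_iff[OF coding_codes(1,1), of "(\<le>)"]
    by (simp add: elts_range[OF coding_codes(1)]) (metis diff_ge_0_iff_ge)
  then have "sat W ?\<phi> (\<lambda>i. star N (?xs ! i))" unfolding transfer .
  then show ?thesis
    using M le sle_iff[OF M star_carrier(1)] sle_iff[OF star_carrier(1)]
    by (auto simp: carrier_hyperreals simp flip: star_zero_one(1) star_real_def)
qed

lemma star_real_uminus: "\<rho> (- r) = \<ominus>\<^bsub>K\<^esub> \<rho> r"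
  using star_real_add[of "- r" r] by (simp add: star_zero_one K.minus_equality)

lemma sabs_star_real [simp]: "sabs K (\<rho> r) = \<rho> \<bar>r\<bar>"
  by (simp add: sabs_def abs_if star_real_uminus flip: star_zero_one)

text \<open>If \<open>M + k = \<rho> t\<close> with \<open>k \<ge> 0\<close>, then
  \<open>\<rho> t\<close> times \<open>z\<close> exceeds \<open>M\<close> times \<open>z\<close> by
  a positive vector. The gap between \<open>r\<close> and \<open>s\<close> offers infinitely many
  \<open>t\<close>, enough to avoid all junk sums.\<close>

lemma fin_smult_le:
  assumes M: "M \<in> carrier K" "sle K M (\<rho> r)" and "r < s" and z: "z \<in> carrier L" "vle L \<zero>\<^bsub>L\<^esub> z"
  shows "vle L (M \<odot>\<^bsub>L\<^esub> z) (\<rho> s \<odot>\<^bsub>L\<^esub> z)"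
proof -
  let ?G = "op_graph V (rcode N) (rcode N) (rcode N) (+)"
  let ?j = "junk_value W h (star N ?G)"
  have addK: "add K = star_op N (rcode N) (rcode N) (rcode N) (+)" by (simp add: hyperreals_def)
  obtain D where D: "finite D" "\<And>x y. (x, y) \<notin> D \<Longrightarrow> \<rho> x \<oplus>\<^bsub>K\<^esub> \<rho> y = ?j (\<rho> (x + y))"
    using star_op_standard[OF coding_codes(1,1,1), of "(+)", folded addK star_real_def] by blast
  have "\<exists>k q c. k \<in> carrier K \<and> sle K \<zero>\<^bsub>K\<^esub> k \<and> q \<in> elts W (star N ?G) \<and> is_pair W q c (\<rho> t) \<and> is_pair W c M k"
    if "t \<in> {r<..<s}" for t
    using hyperreal_difference[OF M(1), of t] hyperreal_order(1)[OF M(1), of r t] M(2) that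
    unfolding op_related_def by auto
  then obtain k q c where kqc: "\<And>t. t \<in> {r<..<s} \<Longrightarrow> k t \<in> carrier K \<and> sle K \<zero>\<^bsub>K\<^esub> (k t) \<and>
      q t \<in> elts W (star N ?G) \<and> is_pair W (q t) (c t) (\<rho> t) \<and> is_pair W (c t) M (k t)"
    by metis
  \<comment> \<open>The graph is functional, so the argument pair \<open>c t\<close> determines its
    value \<open>\<rho> t\<close>; hence only finitely many \<open>c t\<close> are bad.\<close>
  have "inj_on c {r<..<s}"
  proof (rule inj_onI)
    fix t u assume tu: "t \<in> {r<..<s}" "u \<in> {r<..<s}" "c t = c u"
    have "fun_graph W (star N ?G)" using star_fun_graph fun_graph_op[OF coding_codes(1,1,1)] by blast
    then have "\<rho> t = \<rho> u" using kqc[OF tu(1)] kqc[OF tu(2)] tu(3) unfolding fun_graph_def by metis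
    then show "t = u" by (simp add: star_real_def inj_eq[OF inj_codes(1)])
  qed
  then have "finite (c -` bad W \<inter> {r<..<s} \<union> (\<lambda>t. (t, 0)) -` D)"
    using D(1) finite_bad by (intro finite_UnI finite_vimage_IntI finite_vimageI) (auto simp: inj_def)
  moreover have "infinite {r<..<s}" using \<open>r < s\<close> by simp
  ultimately obtain t where t: "t \<in> {r<..<s}" "c t \<notin> bad W" "(t, 0) \<notin> D"
    by (metis (no_types, lifting) IntI UnCI finite_subset subsetI vimageI)
  have kt: "k t \<in> carrier K" "sle K \<zero>\<^bsub>K\<^esub> (k t)" using kqc[OF t(1)] by auto
  have "M \<oplus>\<^bsub>K\<^esub> k t = ?j (\<rho> t)"
    unfolding addK using kqc[OF t(1)] t(2) by (intro star_op_eq_junk_value[OF coding_codes(1,1,1)]) auto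
  \<comment> \<open>The unknown function is evaluated at \<open>\<rho> t\<close> by the neutral law,
    as \<open>(t, 0)\<close> is unexceptional.\<close>
  also have "\<dots> = \<rho> t \<oplus>\<^bsub>K\<^esub> \<rho> 0" using D(2)[OF t(3)] by simp
  also have "\<dots> = \<rho> t" by (simp flip: star_real_add)
  finally have "\<rho> t \<odot>\<^bsub>L\<^esub> z = M \<odot>\<^bsub>L\<^esub> z \<oplus>\<^bsub>L\<^esub> k t \<odot>\<^bsub>L\<^esub> z"
    using M(1) kt z by (simp flip: L.smult_l_distr)
  then have "vle L (M \<odot>\<^bsub>L\<^esub> z) (\<rho> t \<odot>\<^bsub>L\<^esub> z)"
    using L.le_add_nonneg[of "M \<odot>\<^bsub>L\<^esub> z" "k t \<odot>\<^bsub>L\<^esub> z"] L.smult_nonneg[of "k t" z] M(1) kt z by simp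
  moreover have "vle L (\<rho> t \<odot>\<^bsub>L\<^esub> z) (\<rho> s \<odot>\<^bsub>L\<^esub> z)"
  proof -
    have "\<rho> s \<odot>\<^bsub>L\<^esub> z = \<rho> t \<odot>\<^bsub>L\<^esub> z \<oplus>\<^bsub>L\<^esub> \<rho> (s - t) \<odot>\<^bsub>L\<^esub> z"
      using z by (simp flip: L.smult_l_distr star_real_add)
    moreover have "sle K \<zero>\<^bsub>K\<^esub> (\<rho> (s - t))" using t(1) by (simp flip: star_zero_one)
    ultimately show ?thesis
      using L.le_add_nonneg[of "\<rho> t \<odot>\<^bsub>L\<^esub> z" "\<rho> (s - t) \<odot>\<^bsub>L\<^esub> z"] L.smult_nonneg[of "\<rho> (s - t)" z] z
      by simp
  qed
  ultimately show ?thesis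
    using M(1) z L.le_trans[of "M \<odot>\<^bsub>L\<^esub> z" "\<rho> t \<odot>\<^bsub>L\<^esub> z" "\<rho> s \<odot>\<^bsub>L\<^esub> z"] by simp
qed

text \<open>The standard part is the supremum of the reals below \<open>M\<close>; finiteness makes
  that set nonempty and bounded. Uniqueness holds because two candidates differ by at most every
  positive real, so the description in \<open>st\<close> denotes.\<close>

lemma st_approx:
  assumes M: "M \<in> fin_hyperreals N" and "0 < \<delta>"
  shows "sle K (\<rho> (st N M - \<delta>)) M" "sle K M (\<rho> (st N M + \<delta>))"
proof -
  have MK: "M \<in> carrier K" using M by (simp add: fin_hyperreals_def)
  obtain b where b: "sle K (\<rho> (- b)) M" "sle K M (\<rho> b)" using M by (auto simp: fin_hyperreals_def)
  define A where "A = {r. sle K (\<rho> r) M}"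
  have up: "r \<le> s" if "sle K (\<rho> r) M" "sle K M (\<rho> s)" for r s
    using hyperreal_order(4)[OF MK, of s r] that by (cases "r \<le> s") auto
  have A: "A \<noteq> {}" "bdd_above A" using b up by (auto simp: A_def bdd_above_def)
  let ?Q = "\<lambda>r. \<forall>\<epsilon>>0. sle K (\<rho> (r - \<epsilon>)) M \<and> sle K M (\<rho> (r + \<epsilon>))"
  have "?Q (Sup A)"
  proof (intro allI impI conjI)
    fix e :: real assume e: "0 < e"
    obtain r where "r \<in> A" "Sup A - e < r" using less_cSup_iff[OF A, of "Sup A - e"] e by auto
    then show "sle K (\<rho> (Sup A - e)) M" using hyperreal_order(2)[OF MK, of "Sup A - e" r] by (simp add: A_def)
    have "Sup A + e \<notin> A" using cSup_upper[OF _ A(2), of "Sup A + e"] e by auto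
    then show "sle K M (\<rho> (Sup A + e))" using hyperreal_order(3)[OF MK order_refl] by (auto simp: A_def)
  qed
  moreover have "r = s" if "?Q r" "?Q s" for r s
  proof -
    have "r \<le> s" if "?Q r" "?Q s" for r s
    proof (rule field_le_epsilon)
      fix e :: real assume "0 < e"
      then show "r \<le> s + e" using up[of "r - e / 2" "s + e / 2"] that[rule_format, of "e / 2"] by simp
    qed
    from this[of r s] this[of s r] that show ?thesis by simp
  qed
  ultimately have "?Q (st N M)" unfolding st_def by (intro theI[of ?Q]) auto
  with \<open>0 < \<delta>\<close> show "sle K (\<rho> (st N M - \<delta>)) M" "sle K M (\<rho> (st N M + \<delta>))" by auto
qed

end

section \<open>Dedekind complete ordered vector spaces\<close>

lemma field_real_scalars: "field real_scalars"
proof -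
  have "cring real_scalars"
  proof (rule cringI)
    show "abelian_group real_scalars"
      by (rule abelian_groupI) (auto simp: real_scalars_def algebra_simps intro: exI[of _ "- _"])
    show "comm_monoid real_scalars"
      by unfold_locales (auto simp: real_scalars_def)
  qed (auto simp: real_scalars_def algebra_simps)
  then show ?thesis
    by (rule cring.cring_fieldI2) (auto simp: real_scalars_def intro: right_inverse)
qed

lemma cring_real_scalars: "cring real_scalars"
  using field_real_scalars by (simp add: fieldE)

lemma sabs_real_scalars: "sabs real_scalars r = \<bar>r\<bar>"
proof -
  interpret field real_scalars by (rule field_real_scalars)
  have "\<ominus>\<^bsub>real_scalars\<^esub> r = - r"
    by (rule minus_equality) (auto simp: real_scalars_def)
  then show ?thesis by (auto simp: sabs_def real_scalars_def)
qed

lemma vector_lattice_std_space: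
  "vector_lattice real_scalars
     (std_space :: (real, 'e :: {ordered_real_vector, conditionally_complete_lattice}) omodule)"
proof -
  let ?E = "std_space :: (real, 'e) omodule"
  have ab: "abelian_group ?E"
  proof (rule abelian_groupI)
    fix x :: 'e assume "x \<in> carrier ?E"
    show "\<exists>y\<in>carrier ?E. y \<oplus>\<^bsub>?E\<^esub> x = \<zero>\<^bsub>?E\<^esub>"
      by (rule bexI[of _ "- x"]) (auto simp: std_space_def)
  qed (auto simp: std_space_def algebra_simps)
  have "Module.module real_scalars ?E"
  proof (rule moduleI)
    show "cring real_scalars" by (rule cring_real_scalars)
  qed (use ab in \<open>auto simp: std_space_def real_scalars_def algebra_simps\<close>)
  then have "ordered_vector_space real_scalars ?E"
    unfolding ordered_vector_space_def using field_real_scalars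
    by (auto simp: std_space_def real_scalars_def intro: scaleR_left_mono)
  then show ?thesis
    unfolding vector_lattice_def
  proof (intro conjI ballI)
    fix x y :: 'e
    show "\<exists>s\<in>carrier ?E. vle ?E x s \<and> vle ?E y s \<and> (\<forall>u\<in>carrier ?E. vle ?E x u \<longrightarrow> vle ?E y u \<longrightarrow> vle ?E s u)"
      by (rule bexI[of _ "sup x y"]) (auto simp: std_space_def)
    show "\<exists>i\<in>carrier ?E. vle ?E i x \<and> vle ?E i y \<and> (\<forall>u\<in>carrier ?E. vle ?E u x \<longrightarrow> vle ?E u y \<longrightarrow> vle ?E u i)"
      by (rule bexI[of _ "inf x y"]) (auto simp: std_space_def)
  qed
qed

context
  fixes B :: "'e :: {ordered_real_vector, conditionally_complete_lattice} set"
  assumes B: "B \<noteq> {}"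
begin

text \<open>Division by \<open>s\<close> turns the hypothesis into a lower bound of
  \<open>B\<close>; for \<open>s = 0\<close> any member of \<open>B\<close> gives
  \<open>w \<le> 0\<close>.\<close>

lemma le_scaleR_Inf:
  assumes "0 \<le> s" "\<And>e. e \<in> B \<Longrightarrow> w \<le> s *\<^sub>R e"
  shows "w \<le> s *\<^sub>R Inf B"
proof (cases "s = 0")
  case True
  then show ?thesis using assms B by auto
next
  case False
  then have "inverse s *\<^sub>R w \<le> Inf B"
    using assms B scaleR_left_mono[of w "s *\<^sub>R _" "inverse s"] by (intro cInf_greatest) simp_all
  from scaleR_left_mono[OF this assms(1)] show ?thesis using False by simp
qed

text \<open>The infima are taken one after the other: first over \<open>C\<close> with
  \<open>d\<close> fixed, then over \<open>B\<close>.\<close>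

lemma le_Inf_add:
  assumes "C \<noteq> {}" "\<And>d e. d \<in> B \<Longrightarrow> e \<in> C \<Longrightarrow> w \<le> d + e"
  shows "w \<le> Inf B + Inf C"
proof -
  have "w - d \<le> Inf C" if "d \<in> B" for d
    using assms(1) assms(2)[OF that] by (intro cInf_greatest) (auto simp: diff_le_eq add.commute)
  then have "w - Inf C \<le> Inf B"
    using B by (intro cInf_greatest) (auto simp: diff_le_eq add.commute)
  then show ?thesis by (simp add: diff_le_eq)
qed

end

text \<open>If \<open>i\<close> is the infimum of all \<open>\<delta> b\<close>, then \<open>2 i\<close> is a lower bound as well, whence \<open>i \<le> 0\<close>.\<close>

lemma archimedean:
  fixes w b :: "'e :: {ordered_real_vector, conditionally_complete_lattice}"
  assumes w: "\<And>\<delta>. 0 < \<delta> \<Longrightarrow> w \<le> \<delta> *\<^sub>R b"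
  shows "w \<le> 0"
proof -
  let ?B = "(\<lambda>\<delta>. \<delta> *\<^sub>R b) ` {0<..}"
  have bdd: "bdd_below ?B" using w by (auto simp: bdd_below_def)
  have "2 *\<^sub>R Inf ?B \<le> Inf ?B"
  proof (rule cInf_greatest)
    fix x assume "x \<in> ?B"
    then obtain \<delta> where d: "x = \<delta> *\<^sub>R b" "0 < \<delta>" by auto
    have "Inf ?B \<le> (\<delta> / 2) *\<^sub>R b" using d bdd by (intro cInf_lower) auto
    from scaleR_left_mono[OF this, of 2] show "2 *\<^sub>R Inf ?B \<le> x" using d by simp
  qed auto
  then have "Inf ?B \<le> 0" by (simp add: scaleR_2)
  moreover have "w \<le> Inf ?B" using w by (intro cInf_greatest) auto
  ultimately show ?thesis by simp
qed

section \<open>The quotient\<close>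

context internal_space
begin

section \<open>The \<open>E\<close>-valued seminorm on the finite elements\<close>

definition bounds :: "'w \<Rightarrow> 'e set" where
  "bounds x = {e. vle L (P x) (\<epsilon> e)}"

definition nrm :: "'w \<Rightarrow> 'e" where
  "nrm x = Inf (bounds x)"

abbreviation "fins \<equiv> finY N Y p"
abbreviation "infs \<equiv> nY N Y p"
abbreviation "coset \<equiv> cls N Y p"
abbreviation "Q \<equiv> quot_space N Y p"

lemma P: "x \<in> carrier X \<Longrightarrow> P x \<in> carrier L" "x \<in> carrier X \<Longrightarrow> vle L \<zero>\<^bsub>L\<^esub> (P x)"
  using lnovs by (simp_all add: lnovs_def)

lemma P_eq_0_iff: "x \<in> carrier X \<Longrightarrow> P x = \<zero>\<^bsub>L\<^esub> \<longleftrightarrow> x = \<zero>\<^bsub>X\<^esub>"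
  using lnovs by (simp add: lnovs_def)

lemma P_smult: "x \<in> carrier X \<Longrightarrow> P (\<rho> r \<odot>\<^bsub>X\<^esub> x) = \<rho> \<bar>r\<bar> \<odot>\<^bsub>L\<^esub> P x"
  using lnovs by (simp add: lnovs_def)

lemma P_add: "x \<in> carrier X \<Longrightarrow> y \<in> carrier X \<Longrightarrow> vle L (P (x \<oplus>\<^bsub>X\<^esub> y)) (P x \<oplus>\<^bsub>L\<^esub> P y)"
  using lnovs by (simp add: lnovs_def)

lemma bounds_nonneg:
  assumes "x \<in> carrier X" "e \<in> bounds x"
  shows "0 \<le> e"
proof -
  have "vle L (\<epsilon> 0) (\<epsilon> e)"
    using L.le_trans[of "\<epsilon> 0" "P x" "\<epsilon> e"] assms P[OF assms(1)] by (simp add: bounds_def star_zero_one)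
  then show ?thesis by simp
qed

text \<open>Positivity of \<open>P x\<close> supplies the lower estimate. Thus the two-sided
  definitions of finite and infinitesimal vectors reduce to \<open>bounds\<close> and
  \<open>nrm\<close>.\<close>

lemma symmetric_bounds:
  assumes "x \<in> carrier X"
  shows "vle L (\<epsilon> (- e)) (P x) \<and> vle L (P x) (\<epsilon> e) \<longleftrightarrow> e \<in> bounds x"
proof
  assume e: "e \<in> bounds x"
  have "vle L (\<epsilon> (- e)) (\<epsilon> 0)" using bounds_nonneg[OF assms e] by simp
  then have "vle L (\<epsilon> (- e)) (P x)"
    using L.le_trans[of "\<epsilon> (- e)" "\<epsilon> 0" "P x"] P[OF assms] by (simp add: star_zero_one)
  with e show "vle L (\<epsilon> (- e)) (P x) \<and> vle L (P x) (\<epsilon> e)" by (simp add: bounds_def)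
qed (simp add: bounds_def)

lemma mem_fins: "x \<in> fins \<longleftrightarrow> x \<in> carrier X \<and> bounds x \<noteq> {}"
  using symmetric_bounds[of x] P(1)[of x] by (auto simp: finY_def fin_vec_def)

lemma mem_infs: "x \<in> infs \<longleftrightarrow> x \<in> fins \<and> nrm x = 0"
  using symmetric_bounds[of x] by (auto simp: nY_def finY_def eta_vec_def nrm_def)

lemma fins_carrier [simp]: "x \<in> fins \<Longrightarrow> x \<in> carrier X"
  by (simp add: mem_fins)

lemma nrm_le: "x \<in> carrier X \<Longrightarrow> e \<in> bounds x \<Longrightarrow> nrm x \<le> e"
  unfolding nrm_def using bounds_nonneg by (intro cInf_lower) (auto simp: bdd_below_def)

lemma nrm_nonneg: "x \<in> fins \<Longrightarrow> 0 \<le> nrm x"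
  unfolding nrm_def using bounds_nonneg by (intro cInf_greatest) (auto simp: mem_fins)

lemma bounds_add:
  assumes "x \<in> carrier X" "y \<in> carrier X" "d \<in> bounds x" "e \<in> bounds y"
  shows "d + e \<in> bounds (x \<oplus>\<^bsub>X\<^esub> y)"
proof -
  have "vle L (P x \<oplus>\<^bsub>L\<^esub> P y) (\<epsilon> (d + e))"
    using assms P by (simp add: star_vec_add bounds_def L.add_mono)
  then show ?thesis
    using P_add[OF assms(1,2)] assms P L.le_trans[of "P (x \<oplus>\<^bsub>X\<^esub> y)" "P x \<oplus>\<^bsub>L\<^esub> P y" "\<epsilon> (d + e)"]
    by (simp add: bounds_def)
qed

lemma fins_add [simp]: "x \<in> fins \<Longrightarrow> y \<in> fins \<Longrightarrow> x \<oplus>\<^bsub>X\<^esub> y \<in> fins"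
  using bounds_add[of x y] by (fastforce simp: mem_fins)

lemma nrm_add: "x \<in> fins \<Longrightarrow> y \<in> fins \<Longrightarrow> nrm (x \<oplus>\<^bsub>X\<^esub> y) \<le> nrm x + nrm y"
  unfolding nrm_def[of x] nrm_def[of y]
  by (rule le_Inf_add) (auto simp: mem_fins intro!: nrm_le bounds_add)

lemma bounds_smult:
  assumes "x \<in> carrier X" "e \<in> bounds x"
  shows "\<bar>r\<bar> *\<^sub>R e \<in> bounds (\<rho> r \<odot>\<^bsub>X\<^esub> x)"
proof -
  have "sle K \<zero>\<^bsub>K\<^esub> (\<rho> \<bar>r\<bar>)" by (simp flip: star_zero_one)
  then show ?thesis
    using assms P by (simp add: P_smult star_vec_smult bounds_def L.smult_mono)
qed

lemma fins_smult [simp]: "x \<in> fins \<Longrightarrow> \<rho> r \<odot>\<^bsub>X\<^esub> x \<in> fins"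
  using bounds_smult[of x _ r] by (fastforce simp: mem_fins)

lemma fins_zero [simp]: "\<zero>\<^bsub>X\<^esub> \<in> fins"
  and nrm_zero: "nrm \<zero>\<^bsub>X\<^esub> = 0"
proof -
  have "bounds \<zero>\<^bsub>X\<^esub> = {0..}"
    using P_eq_0_iff[of "\<zero>\<^bsub>X\<^esub>"] by (auto simp: bounds_def simp flip: star_zero_one)
  then show "\<zero>\<^bsub>X\<^esub> \<in> fins" "nrm \<zero>\<^bsub>X\<^esub> = 0" by (auto simp: mem_fins nrm_def)
qed

lemma nrm_smult:
  assumes "x \<in> fins"
  shows "nrm (\<rho> r \<odot>\<^bsub>X\<^esub> x) = \<bar>r\<bar> *\<^sub>R nrm x"
proof -
  have le: "nrm (\<rho> r \<odot>\<^bsub>X\<^esub> x) \<le> \<bar>r\<bar> *\<^sub>R nrm x" if "x \<in> fins" for r x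
    unfolding nrm_def[of x]
    by (rule le_scaleR_Inf) (use that in \<open>auto simp: mem_fins intro!: nrm_le bounds_smult\<close>)
  show ?thesis
  proof (cases "r = 0")
    case True
    then show ?thesis using assms by (simp add: star_zero_one X.smult_l_null nrm_zero)
  next
    case False
    \<comment> \<open>The reverse inequality is the proved one for the scalar \<open>1 / r\<close>
      and the scaled vector.\<close>
    have "\<rho> (1 / r) \<odot>\<^bsub>X\<^esub> (\<rho> r \<odot>\<^bsub>X\<^esub> x) = x"
      using assms False by (simp add: star_zero_one flip: X.smult_assoc1 star_real_mult)
    then have "nrm x \<le> \<bar>1 / r\<bar> *\<^sub>R nrm (\<rho> r \<odot>\<^bsub>X\<^esub> x)"
      using le[of "\<rho> r \<odot>\<^bsub>X\<^esub> x" "1 / r"] assms by simp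
    from scaleR_left_mono[OF this, of "\<bar>r\<bar>"] have "\<bar>r\<bar> *\<^sub>R nrm x \<le> nrm (\<rho> r \<odot>\<^bsub>X\<^esub> x)"
      using False by simp
    with le[OF assms, of r] show ?thesis by (rule antisym)
  qed
qed

lemma uminus_eq_smult: "x \<in> carrier X \<Longrightarrow> \<ominus>\<^bsub>X\<^esub> x = \<rho> (- 1) \<odot>\<^bsub>X\<^esub> x"
  by (simp add: star_real_uminus star_zero_one X.smult_l_minus)

lemma fins_uminus [simp]: "x \<in> fins \<Longrightarrow> \<ominus>\<^bsub>X\<^esub> x \<in> fins"
  and nrm_uminus: "x \<in> fins \<Longrightarrow> nrm (\<ominus>\<^bsub>X\<^esub> x) = nrm x"
  by (simp_all add: uminus_eq_smult nrm_smult)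

lemma infs_add: "x \<in> infs \<Longrightarrow> y \<in> infs \<Longrightarrow> x \<oplus>\<^bsub>X\<^esub> y \<in> infs"
  using nrm_add[of x y] nrm_nonneg[of "x \<oplus>\<^bsub>X\<^esub> y"] by (simp add: mem_infs)

section \<open>Cosets of infinitesimals and the quotient operations\<close>

sublocale I: abelian_subgroup infs X
proof (rule abelian_subgroupI3)
  show "additive_subgroup infs X"
  proof (rule additive_subgroup.intro, rule X.add.subgroupI)
    fix x assume "x \<in> infs"
    then show "\<ominus>\<^bsub>X\<^esub> x \<in> infs" by (simp add: mem_infs nrm_uminus)
  next
    have "\<zero>\<^bsub>X\<^esub> \<in> infs" by (simp add: mem_infs nrm_zero)
    then show "infs \<noteq> {}" by blast
  qed (use infs_add in \<open>auto simp: mem_infs\<close>)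
qed (rule X.abelian_group_axioms)

lemma coset_eq_iff:
  assumes "x \<in> carrier X" "y \<in> carrier X"
  shows "coset x = coset y \<longleftrightarrow> x \<ominus>\<^bsub>X\<^esub> y \<in> infs"
proof -
  have "coset x = coset y \<longleftrightarrow> x \<in> coset y"
    unfolding cls_def
    using I.a_repr_independence'[OF _ assms(2), of x] I.a_repr_independenceD[OF assms(1), of y] by metis
  also have "\<dots> \<longleftrightarrow> x \<ominus>\<^bsub>X\<^esub> y \<in> infs"
    unfolding cls_def a_minus_def by (rule I.a_rcos_module[OF assms(2,1)])
  finally show ?thesis .
qed

text \<open>Since \<open>infs\<close> lies inside \<open>fins\<close>, cosets formed in all of
  \<open>X\<close> do not leave the finite elements.\<close>

lemma mem_coset: "x \<in> fins \<Longrightarrow> a \<in> coset x \<Longrightarrow> a \<in> fins \<and> coset a = coset x"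
proof -
  assume x: "x \<in> fins" and a: "a \<in> coset x"
  then obtain i where "i \<in> infs" "a = i \<oplus>\<^bsub>X\<^esub> x" by (auto simp: cls_def a_r_coset_def')
  then show ?thesis using x a I.a_repr_independence'[of a x] by (auto simp: mem_infs cls_def)
qed

lemma self_coset: "x \<in> carrier X \<Longrightarrow> x \<in> coset x"
  by (simp add: cls_def I.a_rcos_self)

lemma nrm_coset: 
  assumes "x \<in> fins" "y \<in> fins" "coset x = coset y"
  shows "nrm x = nrm y"
proof -
  have "nrm x \<le> nrm y" if "x \<in> fins" "y \<in> fins" "coset x = coset y" for x y
  proof -
    have "x = (x \<ominus>\<^bsub>X\<^esub> y) \<oplus>\<^bsub>X\<^esub> y" using that by (simp add: a_minus_def X.a_assoc X.l_neg)
    then show ?thesis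
      using nrm_add[of "x \<ominus>\<^bsub>X\<^esub> y" y] that coset_eq_iff[of x y] by (auto simp: mem_infs)
  qed
  from this[of x y] this[of y x] assms show ?thesis by simp
qed

text \<open>By \<open>nrm_coset\<close> the infimum is constant on the coset, so the description in
  \<open>quot_norm\<close> denotes it.\<close>

lemma quot_norm_coset:
  assumes "x \<in> fins"
  shows "quot_norm N p (coset x) = nrm x"
proof -
  have "u = nrm x" if "a \<in> coset x" "u = nrm a" for a u
    using mem_coset[OF assms that(1)] nrm_coset[OF _ assms, of a] that(2) by simp
  moreover have "x \<in> coset x" using assms by (simp add: self_coset)
  ultimately show ?thesis
    unfolding quot_norm_def nrm_def[unfolded bounds_def, symmetric] by (intro the_equality) blast+
qed

lemma coset_add: "x \<in> carrier X \<Longrightarrow> y \<in> carrier X \<Longrightarrow> coset x <+>\<^bsub>X\<^esub> coset y = coset (x \<oplus>\<^bsub>X\<^esub> y)"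
  unfolding cls_def by (rule I.a_rcos_sum)

lemma coset_smult:
  assumes "x \<in> fins"
  shows "(\<Union>a\<in>coset x. coset (\<rho> r \<odot>\<^bsub>X\<^esub> a)) = coset (\<rho> r \<odot>\<^bsub>X\<^esub> x)"
proof -
  have "coset (\<rho> r \<odot>\<^bsub>X\<^esub> a) = coset (\<rho> r \<odot>\<^bsub>X\<^esub> x)" if "a \<in> coset x" for a
  proof -
    have a: "a \<in> fins" "a \<ominus>\<^bsub>X\<^esub> x \<in> infs"
      using mem_coset[OF assms that] coset_eq_iff[of a x] assms by auto
    have "\<rho> r \<odot>\<^bsub>X\<^esub> a \<ominus>\<^bsub>X\<^esub> \<rho> r \<odot>\<^bsub>X\<^esub> x = \<rho> r \<odot>\<^bsub>X\<^esub> (a \<ominus>\<^bsub>X\<^esub> x)"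
      using a assms by (simp add: a_minus_def X.smult_r_distr X.smult_r_minus)
    then show ?thesis using a assms coset_eq_iff by (simp add: mem_infs nrm_smult)
  qed
  \<comment> \<open>All cosets in the union coincide, and the index set contains \<open>x\<close>,
    so the union is that one coset.\<close>
  then have "(\<Union>a\<in>coset x. coset (\<rho> r \<odot>\<^bsub>X\<^esub> a)) = (\<Union>a\<in>coset x. coset (\<rho> r \<odot>\<^bsub>X\<^esub> x))"
    by (rule SUP_cong[OF refl])
  also have "\<dots> = coset (\<rho> r \<odot>\<^bsub>X\<^esub> x)" using self_coset[of x] assms by (intro UN_constant_eq) auto
  finally show ?thesis .
qed

lemma quot_simps:
  "carrier Q = coset ` fins" "\<zero>\<^bsub>Q\<^esub> = coset \<zero>\<^bsub>X\<^esub>"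
  "x \<in> fins \<Longrightarrow> y \<in> fins \<Longrightarrow> coset x \<oplus>\<^bsub>Q\<^esub> coset y = coset (x \<oplus>\<^bsub>X\<^esub> y)"
  "x \<in> fins \<Longrightarrow> r \<odot>\<^bsub>Q\<^esub> coset x = coset (\<rho> r \<odot>\<^bsub>X\<^esub> x)"
  using coset_add[of x y] coset_smult[of x r]
  by (simp_all add: quot_space_def quot_vs_def module.defs omodule.defs)

text \<open>Stated for any record \<open>R\<close> because it serves twice: for
  \<open>quot_vs\<close>, whose subtraction defines the order, and for \<open>Q\<close>
  itself.\<close>

lemma quot_abelian_groupI:
  assumes "carrier R = coset ` fins" "\<zero>\<^bsub>R\<^esub> = coset \<zero>\<^bsub>X\<^esub>"
    "\<And>x y. x \<in> fins \<Longrightarrow> y \<in> fins \<Longrightarrow> coset x \<oplus>\<^bsub>R\<^esub> coset y = coset (x \<oplus>\<^bsub>X\<^esub> y)"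
  shows "abelian_group R"
proof (rule abelian_groupI)
  fix A assume "A \<in> carrier R"
  then obtain x where x: "x \<in> fins" "A = coset x" by (auto simp: assms)
  then show "\<exists>B\<in>carrier R. B \<oplus>\<^bsub>R\<^esub> A = \<zero>\<^bsub>R\<^esub>"
    by (intro bexI[of _ "coset (\<ominus>\<^bsub>X\<^esub> x)"]) (auto simp: assms X.l_neg)
qed (auto simp: assms X.a_ac)

lemma minus_quot_vs:
  assumes "x \<in> fins" "y \<in> fins"
  shows "coset y \<ominus>\<^bsub>quot_vs N Y p\<^esub> coset x = coset (y \<ominus>\<^bsub>X\<^esub> x)"
proof -
  interpret R: abelian_group "quot_vs N Y p"
    by (rule quot_abelian_groupI) (simp_all add: quot_vs_def coset_add)
  have "\<ominus>\<^bsub>quot_vs N Y p\<^esub> coset x = coset (\<ominus>\<^bsub>X\<^esub> x)"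
    by (rule R.minus_equality) (use assms in \<open>auto simp: quot_vs_def coset_add X.l_neg\<close>)
  then show ?thesis
    using assms by (simp add: a_minus_def quot_vs_def coset_add)
qed

text \<open>The working form of the quotient order: each inequality of classes provides a finite
  positive difference \<open>z\<close>, up to an infinitesimal.\<close>

lemma vle_quot:
  assumes "x \<in> fins" "y \<in> fins"
  shows "vle Q (coset x) (coset y) \<longleftrightarrow> (\<exists>z\<in>fins. vle X \<zero>\<^bsub>X\<^esub> z \<and> coset y = coset (x \<oplus>\<^bsub>X\<^esub> z))"
proof -
  have "vle Q (coset x) (coset y) \<longleftrightarrow> (\<exists>z\<in>fins. vle X \<zero>\<^bsub>X\<^esub> z \<and> coset (y \<ominus>\<^bsub>X\<^esub> x) = coset z)"
    unfolding minus_quot_vs[OF assms, symmetric]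
    by (auto simp: quot_space_def module.defs omodule.defs quot_pos_def)
  moreover have "coset (y \<ominus>\<^bsub>X\<^esub> x) = coset z \<longleftrightarrow> coset y = coset (x \<oplus>\<^bsub>X\<^esub> z)" if "z \<in> fins" for z
  proof -
    have "(y \<ominus>\<^bsub>X\<^esub> x) \<ominus>\<^bsub>X\<^esub> z = y \<ominus>\<^bsub>X\<^esub> (x \<oplus>\<^bsub>X\<^esub> z)"
      using assms that by (simp add: a_minus_def X.minus_add X.a_assoc)
    then show ?thesis using assms that by (simp add: coset_eq_iff)
  qed
  ultimately show ?thesis by auto
qed

lemma module_quot: "Module.module real_scalars Q"
proof (rule moduleI)
  show "cring real_scalars" by (rule cring_real_scalars)
  show "abelian_group Q" by (rule quot_abelian_groupI) (simp_all add: quot_simps)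
qed (auto simp: quot_simps real_scalars_def star_real_add star_real_mult
    star_zero_one X.smult_l_distr X.smult_r_distr X.smult_assoc1)

end

section \<open>Consequences of semimonotonicity\<close>

locale semimonotone_space = internal_space N h n Y p
  for N :: "('v, 'w, 'e :: {ordered_real_vector, conditionally_complete_lattice}) nsa" and h n Y p +
  fixes M :: 'w
  assumes M: "M \<in> fin_hyperreals N"
    and semimonotone: "semimonotone X L P M"
begin

text \<open>The maximum with 0 keeps the constant nonnegative, so that multiplying bounds by it
  preserves the order.\<close>

lemma nrm_semimonotone_approx:
  assumes x: "x \<in> fins" and y: "y \<in> fins" and "vle X \<zero>\<^bsub>X\<^esub> y" "vle X y x" and "0 < \<delta>"
  shows "nrm y \<le> max (st N M + \<delta>) 0 *\<^sub>R nrm x"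
proof -
  define s where "s = max (st N M + \<delta>) 0"
  have s: "0 \<le> s" "sle K \<zero>\<^bsub>K\<^esub> (\<rho> s)" by (simp_all add: s_def flip: star_zero_one)
  have MK: "M \<in> carrier K" using M by (simp add: fin_hyperreals_def)
  have "vle L (P y) (M \<odot>\<^bsub>L\<^esub> P x)"
    using semimonotone assms by (simp add: semimonotone_def)
  \<comment> \<open>Half of \<open>\<delta>\<close> goes into the bound on \<open>M\<close>; the
    other half leaves the strict gap that \<open>fin_smult_le\<close> asks for.\<close>
  moreover have "vle L (M \<odot>\<^bsub>L\<^esub> P x) (\<rho> s \<odot>\<^bsub>L\<^esub> P x)"
    by (rule fin_smult_le[OF MK st_approx(2)[OF M, of "\<delta> / 2"]]) (use assms P in \<open>auto simp: s_def\<close>)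
  ultimately have 1: "vle L (P y) (\<rho> s \<odot>\<^bsub>L\<^esub> P x)"
    using L.le_trans[of "P y" "M \<odot>\<^bsub>L\<^esub> P x" "\<rho> s \<odot>\<^bsub>L\<^esub> P x"] MK x y P by simp
  have "s *\<^sub>R e \<in> bounds y" if "e \<in> bounds x" for e
    using L.smult_mono[of "\<rho> s" "P x" "\<epsilon> e"] 1 s that x y P
      L.le_trans[of "P y" "\<rho> s \<odot>\<^bsub>L\<^esub> P x" "\<epsilon> (s *\<^sub>R e)"]
    by (simp add: bounds_def star_vec_smult)
  then show ?thesis
    unfolding nrm_def[of x] s_def[symmetric]
    by (intro le_scaleR_Inf) (use x y s in \<open>auto simp: mem_fins intro!: nrm_le\<close>)
qed

lemma nrm_semimonotone:
  assumes x: "x \<in> fins" and y: "y \<in> fins" and "vle X \<zero>\<^bsub>X\<^esub> y" "vle X y x"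
  shows "nrm y \<le> st N M *\<^sub>R nrm x"
proof (cases "st N M < 0")
  case True
  text \<open>A negative constant is possible only when \<open>\<zero>\<close> is the only positive element.\<close>
  have "nrm z \<le> 0" if "z \<in> fins" "vle X \<zero>\<^bsub>X\<^esub> z" "vle X z x" for z
    using nrm_semimonotone_approx[OF x that, of "- st N M"] True by simp
  \<comment> \<open>Here \<open>\<delta> = - st N M\<close> made the constant zero. Taking
    \<open>z = x\<close> as well gives \<open>nrm x = 0\<close>, so the right side of the claim
    vanishes.\<close>
  from this[OF y] this[OF x] show ?thesis
    using assms X.le_trans[of "\<zero>\<^bsub>X\<^esub>" y x] X.le_refl[of x] nrm_nonneg[OF x] by simp
next
  case False
  have "nrm y - st N M *\<^sub>R nrm x \<le> 0"
  proof (rule archimedean)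
    fix \<delta> :: real assume "0 < \<delta>"
    then show "nrm y - st N M *\<^sub>R nrm x \<le> \<delta> *\<^sub>R nrm x"
      using nrm_semimonotone_approx[OF assms, of \<delta>] False
      by (simp add: max_def scaleR_left_distrib diff_le_eq add.commute)
  qed
  then show ?thesis by simp
qed

lemma quot_antisym:
  assumes "x \<in> fins" "y \<in> fins" "vle Q (coset x) (coset y)" "vle Q (coset y) (coset x)"
  shows "coset x = coset y"
proof -
  obtain z where z: "z \<in> fins" "vle X \<zero>\<^bsub>X\<^esub> z" "coset y = coset (x \<oplus>\<^bsub>X\<^esub> z)"
    using assms vle_quot by blast
  obtain w where w: "w \<in> fins" "vle X \<zero>\<^bsub>X\<^esub> w" "coset x = coset (y \<oplus>\<^bsub>X\<^esub> w)"
    using assms vle_quot by blast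
  have "coset (x \<oplus>\<^bsub>X\<^esub> (z \<oplus>\<^bsub>X\<^esub> w)) = coset (x \<oplus>\<^bsub>X\<^esub> z) <+>\<^bsub>X\<^esub> coset w"
    using assms z w by (simp add: coset_add X.a_assoc)
  also have "\<dots> = coset x" unfolding z(3)[symmetric] using assms w by (simp add: coset_add)
  finally have "x \<oplus>\<^bsub>X\<^esub> (z \<oplus>\<^bsub>X\<^esub> w) \<ominus>\<^bsub>X\<^esub> x \<in> infs"
    using coset_eq_iff[of "x \<oplus>\<^bsub>X\<^esub> (z \<oplus>\<^bsub>X\<^esub> w)" x] assms z w by simp
  moreover have "x \<oplus>\<^bsub>X\<^esub> (z \<oplus>\<^bsub>X\<^esub> w) \<ominus>\<^bsub>X\<^esub> x = z \<oplus>\<^bsub>X\<^esub> w"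
    using assms z w X.a_comm[of x "z \<oplus>\<^bsub>X\<^esub> w"] by (simp add: a_minus_def X.a_assoc X.r_neg)
  ultimately have "nrm (z \<oplus>\<^bsub>X\<^esub> w) = 0" by (simp add: mem_infs)
  \<comment> \<open>Semimonotonicity for \<open>0 \<le> z \<le> z + w\<close> keeps two positive
    elements from cancelling modulo infinitesimals.\<close>
  moreover have "nrm z \<le> st N M *\<^sub>R nrm (z \<oplus>\<^bsub>X\<^esub> w)"
    using z w by (intro nrm_semimonotone X.le_add_nonneg) auto
  ultimately have "nrm z = 0" using nrm_nonneg[OF z(1)] by simp
  then have "(x \<oplus>\<^bsub>X\<^esub> z) \<ominus>\<^bsub>X\<^esub> x \<in> infs"
    using assms z X.a_comm[of x z] by (simp add: a_minus_def X.a_assoc X.r_neg mem_infs)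
  then show ?thesis using z assms coset_eq_iff[of "x \<oplus>\<^bsub>X\<^esub> z" x] by simp
qed

text \<open>By \<open>vle_quot\<close> each order law needs a positive difference: zero for
  reflexivity, \<open>z + w\<close> for transitivity, the same \<open>z\<close> for translation, its
  multiple for scaling. Antisymmetry is \<open>quot_antisym\<close>.\<close>

lemma ordered_vector_space_quot: "ordered_vector_space real_scalars Q"
  unfolding ordered_vector_space_def
proof (intro conjI ballI impI field_real_scalars module_quot)
  fix A assume "A \<in> carrier Q"
  then obtain x where x: "x \<in> fins" "A = coset x" by (auto simp: quot_simps)
  then show "vle Q A A"
    using vle_quot[of x x] X.le_refl[of "\<zero>\<^bsub>X\<^esub>"] by (auto intro!: bexI[of _ "\<zero>\<^bsub>X\<^esub>"])
next
  fix A B assume "A \<in> carrier Q" "B \<in> carrier Q" "vle Q A B" "vle Q B A"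
  then show "A = B" using quot_antisym by (auto simp: quot_simps)
next
  fix A B C assume "A \<in> carrier Q" "B \<in> carrier Q" "C \<in> carrier Q" and le: "vle Q A B" "vle Q B C"
  then obtain a b c where abc: "a \<in> fins" "b \<in> fins" "c \<in> fins" "A = coset a" "B = coset b" "C = coset c"
    by (auto simp: quot_simps)
  obtain z where z: "z \<in> fins" "vle X \<zero>\<^bsub>X\<^esub> z" "coset b = coset (a \<oplus>\<^bsub>X\<^esub> z)"
    using vle_quot[of a b] abc le by auto
  obtain w where w: "w \<in> fins" "vle X \<zero>\<^bsub>X\<^esub> w" "coset c = coset (b \<oplus>\<^bsub>X\<^esub> w)"
    using vle_quot[of b c] abc le by auto
  have "coset c = coset (a \<oplus>\<^bsub>X\<^esub> z) <+>\<^bsub>X\<^esub> coset w"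
    unfolding z(3)[symmetric] using w abc by (simp add: coset_add)
  then have "coset c = coset (a \<oplus>\<^bsub>X\<^esub> (z \<oplus>\<^bsub>X\<^esub> w))"
    using abc z w by (simp add: coset_add X.a_assoc)
  then show "vle Q A C"
    using vle_quot[of a c] abc z w X.add_nonneg[of z w] by (auto intro!: bexI[of _ "z \<oplus>\<^bsub>X\<^esub> w"])
next
  fix A B C assume "A \<in> carrier Q" "B \<in> carrier Q" "C \<in> carrier Q" and le: "vle Q A B"
  then obtain a b c where abc: "a \<in> fins" "b \<in> fins" "c \<in> fins" "A = coset a" "B = coset b" "C = coset c"
    by (auto simp: quot_simps)
  obtain z where z: "z \<in> fins" "vle X \<zero>\<^bsub>X\<^esub> z" "coset b = coset (a \<oplus>\<^bsub>X\<^esub> z)"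
    using vle_quot[of a b] abc le by auto
  have "coset (b \<oplus>\<^bsub>X\<^esub> c) = coset (a \<oplus>\<^bsub>X\<^esub> z) <+>\<^bsub>X\<^esub> coset c"
    unfolding z(3)[symmetric] using abc by (simp add: coset_add)
  also have "\<dots> = coset ((a \<oplus>\<^bsub>X\<^esub> c) \<oplus>\<^bsub>X\<^esub> z)"
    using abc z by (simp add: coset_add X.a_ac)
  finally have "vle Q (coset (a \<oplus>\<^bsub>X\<^esub> c)) (coset (b \<oplus>\<^bsub>X\<^esub> c))"
    using vle_quot[of "a \<oplus>\<^bsub>X\<^esub> c" "b \<oplus>\<^bsub>X\<^esub> c"] abc(1-3) z(1,2) by auto
  then show "vle Q (A \<oplus>\<^bsub>Q\<^esub> C) (B \<oplus>\<^bsub>Q\<^esub> C)"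
    using abc by (simp add: quot_simps)
next
  fix r A B assume "A \<in> carrier Q" "B \<in> carrier Q" and le: "vle Q A B" and "sle real_scalars \<zero>\<^bsub>real_scalars\<^esub> r"
  then obtain a b where ab: "a \<in> fins" "b \<in> fins" "A = coset a" "B = coset b" and r: "0 \<le> r"
    by (auto simp: quot_simps real_scalars_def)
  obtain z where z: "z \<in> fins" "vle X \<zero>\<^bsub>X\<^esub> z" "coset b = coset (a \<oplus>\<^bsub>X\<^esub> z)"
    using vle_quot[of a b] ab le by auto
  have "sle K \<zero>\<^bsub>K\<^esub> (\<rho> r)" using r by (simp flip: star_zero_one)
  then have nonneg: "vle X \<zero>\<^bsub>X\<^esub> (\<rho> r \<odot>\<^bsub>X\<^esub> z)" using z by (simp add: X.smult_nonneg)
  have "coset (\<rho> r \<odot>\<^bsub>X\<^esub> b) = r \<odot>\<^bsub>Q\<^esub> coset b" using ab by (simp add: quot_simps)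
  also have "\<dots> = coset (\<rho> r \<odot>\<^bsub>X\<^esub> a \<oplus>\<^bsub>X\<^esub> \<rho> r \<odot>\<^bsub>X\<^esub> z)"
    unfolding z(3) using ab z by (simp add: quot_simps X.smult_r_distr)
  finally have "vle Q (coset (\<rho> r \<odot>\<^bsub>X\<^esub> a)) (coset (\<rho> r \<odot>\<^bsub>X\<^esub> b))"
    using vle_quot[of "\<rho> r \<odot>\<^bsub>X\<^esub> a" "\<rho> r \<odot>\<^bsub>X\<^esub> b"] ab(1,2) z(1) nonneg fins_smult by blast
  then show "vle Q (r \<odot>\<^bsub>Q\<^esub> A) (r \<odot>\<^bsub>Q\<^esub> B)"
    using ab by (simp add: quot_simps)
qed

lemma lnovs_quot: "lnovs real_scalars Q std_space (quot_norm N p)"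
  unfolding lnovs_def
proof (intro conjI ballI ordered_vector_space_quot vector_lattice_std_space)
  fix A assume "A \<in> carrier Q"
  then obtain x where x: "x \<in> fins" "A = coset x" by (auto simp: quot_simps)
  show "quot_norm N p A \<in> carrier std_space" by (simp add: std_space_def)
  show "vle std_space \<zero>\<^bsub>std_space\<^esub> (quot_norm N p A)"
    using x by (simp add: std_space_def quot_norm_coset nrm_nonneg)
  show "quot_norm N p A = \<zero>\<^bsub>std_space\<^esub> \<longleftrightarrow> A = \<zero>\<^bsub>Q\<^esub>"
  proof -
    have "\<ominus>\<^bsub>X\<^esub> \<zero>\<^bsub>X\<^esub> = \<zero>\<^bsub>X\<^esub>" by (rule X.minus_equality) simp_all
    then have "x \<ominus>\<^bsub>X\<^esub> \<zero>\<^bsub>X\<^esub> = x" using x by (simp add: a_minus_def)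
    then show ?thesis
      using x coset_eq_iff[of x "\<zero>\<^bsub>X\<^esub>"]
      by (simp add: std_space_def quot_norm_coset quot_simps mem_infs)
  qed
  show "quot_norm N p (r \<odot>\<^bsub>Q\<^esub> A) = sabs real_scalars r \<odot>\<^bsub>std_space\<^esub> quot_norm N p A" for r
    using x by (simp add: std_space_def quot_norm_coset quot_simps nrm_smult sabs_real_scalars)
  fix B assume "B \<in> carrier Q"
  then obtain y where "y \<in> fins" "B = coset y" by (auto simp: quot_simps)
  then show "vle std_space (quot_norm N p (A \<oplus>\<^bsub>Q\<^esub> B)) (quot_norm N p A \<oplus>\<^bsub>std_space\<^esub> quot_norm N p B)"
    using x by (simp add: std_space_def quot_norm_coset quot_simps nrm_add)
qed

text \<open>The classes have comparable representatives: some \<open>x \<ge> 0\<close> for the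
  smaller and \<open>x + z \<ge> x\<close> for the larger. The estimate for \<open>nrm\<close>
  applies to these.\<close>

lemma semimonotone_quot: "semimonotone Q std_space (quot_norm N p) (st N M)"
  unfolding semimonotone_def
proof (intro ballI impI)
  fix B A assume "B \<in> carrier Q" "A \<in> carrier Q" and le: "vle Q \<zero>\<^bsub>Q\<^esub> A" "vle Q A B"
  then obtain a b where ab: "a \<in> fins" "b \<in> fins" "A = coset a" "B = coset b" by (auto simp: quot_simps)
  obtain x where x: "x \<in> fins" "vle X \<zero>\<^bsub>X\<^esub> x" "coset a = coset x"
    using le vle_quot[of "\<zero>\<^bsub>X\<^esub>" a] ab by (auto simp: quot_simps)
  obtain z where z: "z \<in> fins" "vle X \<zero>\<^bsub>X\<^esub> z" "coset b = coset (x \<oplus>\<^bsub>X\<^esub> z)"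
    using le vle_quot[of x b] ab x by auto
  have "nrm x \<le> st N M *\<^sub>R nrm (x \<oplus>\<^bsub>X\<^esub> z)"
    using x z by (intro nrm_semimonotone X.le_add_nonneg) auto
  then show "vle std_space (quot_norm N p A) (st N M \<odot>\<^bsub>std_space\<^esub> quot_norm N p B)"
    using x z ab by (simp add: std_space_def quot_norm_coset)
qed

end

theorem theorem5:
  fixes N :: "('v, 'w, 'e :: {ordered_real_vector, conditionally_complete_lattice}) nsa"
    and h :: enat and Y :: "'w int_space" and p M :: 'w
  assumes "polysaturated_enlargement N h"
    and "internal_lnovs N Y p"
    and "M \<in> fin_hyperreals N"
    and "semimonotone (space_of N Y) (star_space N) (app (nst N) p) M"
  shows "ordered_vector_space real_scalars (quot_space N Y p) \<and>
    lnovs real_scalars (quot_space N Y p) std_space (quot_norm N p) \<and>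
    semimonotone (quot_space N Y p) std_space (quot_norm N p) (st N M)"
proof -
  obtain n where "enat (n + 5) \<le> h" "range (rcode N) \<union> range (ecode N) \<subseteq> level (std N) n"
    using assms(1) by (auto simp: polysaturated_enlargement_def)
  then interpret semimonotone_space N h n Y p M
    using assms by unfold_locales auto
  show ?thesis using ordered_vector_space_quot lnovs_quot semimonotone_quot by blast
qed

end
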